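(* For every finite semigroup $S$, the problem $\mathrm{SMP}(S)$ is in $\mathrm{PSPACE}$.
   Context: For a fixed finite semigroup $S$, the subpower membership problem $\mathrm{SMP}(S)$ is the following decision problem. Input: $n\in\mathbb{N}$ and tuples $\{a_1,\ldots,a_k\}\subseteq S^n$, $b\in S^n$. Problem: is $b$ in the subsemigroup $\langle a_1,\ldots,a_k\rangle$ of the direct power $S^n$ (componentwise multiplication) generated by $\{a_1,\ldots,a_k\}$, i.e. is $b$ a nonempty finite product of elements of $\{a_1,\dots,a_k\}$? The semigroup $S$ is not part of the input; the input size is essentially $n(k+1)$. *)

theory Defs
  imports Main "HOL-Computational_Algebra.Polynomial"
begin

section \<open>Deterministic multi-tape Turing machines\<close>

text \<open>
  Tape symbols over an input alphabet \<open>'a\<close>: the blank, the input letters, and a supply of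
  auxiliary work symbols, of which a given machine uses only finitely many.
\<close>

datatype 'a symbol = Blank | Letter 'a | Aux nat

datatype direction = Left | Stay | Right

text \<open>
  In state \<open>q\<close>, reading the list of symbols \<open>gs\<close> (one for each tape), \<open>tm_delta M q gs\<close> gives the
  next state and for each tape the symbol to be written and the direction in which to move.
\<close>

record ('q, 'a) tm =
  tm_tapes :: nat
  tm_states :: "'q set"
  tm_symbols :: "'a symbol set"
  tm_start :: 'q
  tm_accept :: 'q
  tm_reject :: 'q
  tm_delta :: "'q \<Rightarrow> 'a symbol list \<Rightarrow> 'q \<times> ('a symbol \<times> direction) list"

definition tm_wf :: "('q, 'a) tm \<Rightarrow> bool" where
  "tm_wf M \<longleftrightarrow>
     1 \<le> tm_tapes M \<and>
     finite (tm_states M) \<and> {tm_start M, tm_accept M, tm_reject M} \<subseteq> tm_states M \<and>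
     tm_accept M \<noteq> tm_reject M \<and>
     finite (tm_symbols M) \<and> insert Blank (range Letter) \<subseteq> tm_symbols M \<and>
     (\<forall>q \<in> tm_states M - {tm_accept M, tm_reject M}. \<forall>gs.
        length gs = tm_tapes M \<and> set gs \<subseteq> tm_symbols M \<longrightarrow>
        (case tm_delta M q gs of (q', as) \<Rightarrow>
           q' \<in> tm_states M \<and> length as = tm_tapes M \<and> fst ` set as \<subseteq> tm_symbols M))"

text \<open>Tapes are infinite in both directions: cell contents, and position of the head.\<close>

type_synonym 'a tape = "(int \<Rightarrow> 'a symbol) \<times> int"

type_synonym ('q, 'a) config = "'q \<times> 'a tape list"

fun read :: "'a tape \<Rightarrow> 'a symbol" where
  "read (c, h) = c h"

fun shift :: "direction \<Rightarrow> int" where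
  "shift Left = -1"
| "shift Stay = 0"
| "shift Right = 1"

fun act :: "'a symbol \<times> direction \<Rightarrow> 'a tape \<Rightarrow> 'a tape" where
  "act (g, d) (c, h) = (c(h := g), h + shift d)"

text \<open>A halted machine keeps its configuration forever.\<close>

fun step :: "('q, 'a) tm \<Rightarrow> ('q, 'a) config \<Rightarrow> ('q, 'a) config" where
  "step M (q, ts) =
     (if q \<in> {tm_accept M, tm_reject M} then (q, ts)
      else case tm_delta M q (map read ts) of (q', as) \<Rightarrow> (q', map2 act as ts))"

definition blank_tape :: "'a tape" where
  "blank_tape = (\<lambda>_. Blank, 0)"

definition input_tape :: "'a list \<Rightarrow> 'a tape" where
  "input_tape w = (\<lambda>i. if 0 \<le> i \<and> i < int (length w) then Letter (w ! nat i) else Blank, 0)"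

definition init :: "('q, 'a) tm \<Rightarrow> 'a list \<Rightarrow> ('q, 'a) config" where
  "init M w = (tm_start M, input_tape w # replicate (tm_tapes M - 1) blank_tape)"

definition run :: "('q, 'a) tm \<Rightarrow> 'a list \<Rightarrow> nat \<Rightarrow> ('q, 'a) config" where
  "run M w t = (step M ^^ t) (init M w)"

definition decides :: "('q, 'a) tm \<Rightarrow> 'a list set \<Rightarrow> bool" where
  "decides M L \<longleftrightarrow>
     (\<forall>w. \<exists>t. fst (run M w t) = (if w \<in> L then tm_accept M else tm_reject M))"

text \<open>
  The number of cells, over all tapes including the input tape, that are scanned by a head
  within the first \<open>t\<close> steps on input \<open>w\<close>.
\<close>

definition scanned_cells :: "('q, 'a) tm \<Rightarrow> 'a list \<Rightarrow> nat \<Rightarrow> nat" where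
  "scanned_cells M w t = card {(i, snd (snd (run M w s) ! i)) | i s. i < tm_tapes M \<and> s \<le> t}"

text \<open>
  Since a machine has only finitely many states, it is no restriction to name them by natural
  numbers.
\<close>

definition PSPACE :: "'a::finite list set set" where
  "PSPACE = {L. \<exists>(M :: (nat, 'a) tm) (p :: nat poly).
     tm_wf M \<and> decides M L \<and> (\<forall>w t. scanned_cells M w t \<le> poly p (length w))}"


section \<open>The subpower membership problem\<close>

inductive_set generated :: "('b \<Rightarrow> 'b \<Rightarrow> 'b) \<Rightarrow> 'b set \<Rightarrow> 'b set"
  for f :: "'b \<Rightarrow> 'b \<Rightarrow> 'b" and A :: "'b set" where
  gen: "x \<in> A \<Longrightarrow> x \<in> generated f A"
| mult: "x \<in> generated f A \<Longrightarrow> y \<in> generated f A \<Longrightarrow> f x y \<in> generated f A"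

text \<open>
  Elements of the direct power \<open>S\<^sup>n\<close> are lists of length \<open>n\<close>, with componentwise multiplication
  \<open>map2 mul\<close>.  An instance \<open>(n, [a\<^sub>1, \<dots>, a\<^sub>k], b)\<close> lists the generators; \<open>k = 0\<close> and \<open>n = 0\<close> are
  allowed.
\<close>

definition power_carrier :: "nat \<Rightarrow> 's list set" where
  "power_carrier n = {x. length x = n}"

definition SMP_instances :: "(nat \<times> 's list list \<times> 's list) set" where
  "SMP_instances = {(n, as, b). set as \<subseteq> power_carrier n \<and> b \<in> power_carrier n}"

definition SMP :: "('s \<Rightarrow> 's \<Rightarrow> 's) \<Rightarrow> (nat \<times> 's list list \<times> 's list) set" where
  "SMP mul = {(n, as, b) \<in> SMP_instances. b \<in> generated (map2 mul) (set as)}"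

text \<open>
  Instances are written as words \<open>b # a\<^sub>1 # \<dots> # a\<^sub>k\<close> over \<open>S\<close> extended by a separator \<open>None\<close>, of
  length \<open>n(k+1) + k\<close>.  The number \<open>n\<close> is the length of the first block, so it need not be
  written down separately.
\<close>

fun encode :: "nat \<times> 's list list \<times> 's list \<Rightarrow> 's option list" where
  "encode (n, as, b) = map Some b @ concat (map (\<lambda>a. None # map Some a) as)"

definition SMP_language :: "('s \<Rightarrow> 's \<Rightarrow> 's) \<Rightarrow> 's option list set" where
  "SMP_language mul = encode ` SMP mul"

lemma length_encode:
  assumes "(n, as, b) \<in> SMP_instances"
  shows "length (encode (n, as, b)) = n * (length as + 1) + length as"
proof -
  have "length (concat (map (\<lambda>a. None # map Some a) as)) = n * length as + length as"
    if "set as \<subseteq> power_carrier n" for as :: "'a list list"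
    using that by (induction as) (auto simp: power_carrier_def)
  then show ?thesis
    using assms by (auto simp: SMP_instances_def power_carrier_def)
qed

lemma encode_eq_iff:
  "encode (n, as, b) = encode (m, cs, d) \<longleftrightarrow> as = cs \<and> b = d"
proof -
  have "as = cs \<and> b = d" if "encode (n, as, b) = encode (m, cs, d)"
    using that
  proof (induction as arbitrary: b cs d)
    case Nil
    then have "None \<notin> set (encode (m, cs, d))"
      by (metis Un_iff append_Nil2 concat.simps(1) encode.simps ex_map_conv list.map(1) option.distinct(1))
    then have "cs = []" by (cases cs) auto
    with Nil show ?case by (auto simp: inj_map_eq_map)
  next
    case (Cons a as)
    then have "None \<in> set (encode (m, cs, d))"
      by (metis (no_types, lifting) append_Cons concat.simps(2) encode.simps in_set_conv_decomp list.map(2))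
    then obtain c cs' where cs: "cs = c # cs'"
      by (cases cs) auto
    have eq: "map Some b @ None # encode (n, as, a) = map Some d @ None # encode (m, cs', c)"
      using Cons.prems cs by simp
    have no: "None \<notin> set (map Some b)" "None \<notin> set (map Some d)" by auto
    have "map Some b = map Some d \<and> encode (n, as, a) = encode (m, cs', c)"
      using arg_cong[OF eq, of "takeWhile (\<lambda>x. x \<noteq> None)"]
        arg_cong[OF eq, of "dropWhile (\<lambda>x. x \<noteq> None)"] no
      by (simp add: takeWhile_append dropWhile_append del: encode.simps)
    then show ?case
      using Cons.IH cs by (auto simp: inj_map_eq_map simp del: encode.simps)
  qed
  then show ?thesis by auto
qed

lemma inj_on_encode: "inj_on encode SMP_instances"
  by (auto simp: inj_on_def SMP_instances_def power_carrier_def encode_eq_iff simp del: encode.simps)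

end

(* Every product can be bracketed as a binary tree with generators at the leaves, and an element of
   S^n has a product of at most card S ^ n factors, hence a tree of height at most n * card S.
   As in Savitch's theorem, a depth-first search for such a tree, which enumerates all factorizations
   x = y z and tests y and z recursively, keeps only one frame (x, y, z) per level and so
   needs quadratic space. *)

theory Submission
  imports Defs "HOL-Library.Countable" "HOL-Library.Cardinality"
begin

section \<open>Machines with countable state types\<close>

text \<open>Membership in PSPACE asks for one explicit deterministic machine that halts on every
  word, malformed ones included, and whose heads stay within polynomial bounds at all times.
  Therefore correctness and head bounds are carried together by a single reachability relation. A
  height of about n * log2 (card S) would suffice, but n * card S is easier to provide: card S marks
  are laid down for every letter of b while it is read, and card S \<le> 2 ^ card S. The marks form
  a unary depth counter, and their two values record which of the two recursive calls is pending.
  The pairs (y, z) are enumerated by counting in base (card S)^2 inside the frame itself. Running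
  time is not bounded; only termination is shown.\<close>

definition rename_states :: "('q::countable, 'a) tm \<Rightarrow> (nat, 'a) tm" where
  "rename_states M =
    \<lparr>tm_tapes = tm_tapes M, tm_states = to_nat ` tm_states M, tm_symbols = tm_symbols M,
     tm_start = to_nat (tm_start M), tm_accept = to_nat (tm_accept M),
     tm_reject = to_nat (tm_reject M),
     tm_delta = (\<lambda>k gs. apfst to_nat (tm_delta M (from_nat k) gs))\<rparr>"

lemma tm_wf_rename_states:
  assumes "tm_wf M"
  shows "tm_wf (rename_states M)"
proof -
  have trans: "case apfst to_nat (tm_delta M q gs) of (q', as) \<Rightarrow>
      q' \<in> to_nat ` tm_states M \<and> length as = tm_tapes M \<and> fst ` set as \<subseteq> tm_symbols M"
    if "q \<in> tm_states M" "q \<noteq> tm_accept M" "q \<noteq> tm_reject M"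
      "length gs = tm_tapes M" "set gs \<subseteq> tm_symbols M" for q gs
  proof -
    have "case tm_delta M q gs of (q', as) \<Rightarrow>
        q' \<in> tm_states M \<and> length as = tm_tapes M \<and> fst ` set as \<subseteq> tm_symbols M"
      using assms that unfolding tm_wf_def by simp
    then show ?thesis by (simp add: case_prod_beta)
  qed
  have "case tm_delta (rename_states M) k gs of (q', as) \<Rightarrow>
      q' \<in> tm_states (rename_states M) \<and> length as = tm_tapes (rename_states M) \<and>
      fst ` set as \<subseteq> tm_symbols (rename_states M)"
    if "k \<in> tm_states (rename_states M) -
        {tm_accept (rename_states M), tm_reject (rename_states M)}"
      "length gs = tm_tapes (rename_states M)" "set gs \<subseteq> tm_symbols (rename_states M)"
    for k gs
  proof -
    from that obtain q where "k = to_nat q" "q \<in> tm_states M" "q \<noteq> tm_accept M" "q \<noteq> tm_reject M"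
      by (auto simp: rename_states_def)
    with trans[of q gs] that show ?thesis by (simp add: rename_states_def)
  qed
  moreover have "1 \<le> tm_tapes M" "finite (tm_states M)" "finite (tm_symbols M)"
    "{tm_start M, tm_accept M, tm_reject M} \<subseteq> tm_states M" "tm_accept M \<noteq> tm_reject M"
    "insert Blank (range Letter) \<subseteq> tm_symbols M"
    using assms unfolding tm_wf_def by simp_all
  ultimately show ?thesis
    unfolding tm_wf_def by (simp add: rename_states_def)
qed

lemma step_rename_states:
  "step (rename_states M) (apfst to_nat c) = apfst to_nat (step M c)"
  by (cases c) (auto simp: rename_states_def split: prod.splits)

lemma run_rename_states: "run (rename_states M) w t = apfst to_nat (run M w t)"
proof (induction t)
  case 0
  show ?case by (simp add: run_def init_def) (simp add: rename_states_def)
qed (simp add: run_def step_rename_states)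

text \<open>An injection of the states into the naturals commutes with every step and leaves the
  heads alone, so verdicts and scanned cells carry over.\<close>

lemma PSPACE_I:
  fixes M :: "('q::countable, 'a::finite) tm"
  assumes "tm_wf M" "decides M L" "\<And>w t. scanned_cells M w t \<le> poly p (length w)"
  shows "L \<in> PSPACE"
proof -
  have "\<exists>t. fst (run (rename_states M) w t) =
      (if w \<in> L then tm_accept (rename_states M) else tm_reject (rename_states M))" for w
  proof -
    obtain t where "fst (run M w t) = (if w \<in> L then tm_accept M else tm_reject M)"
      using assms(2) unfolding decides_def by blast
    then show ?thesis
      by (intro exI[of _ t]) (simp add: run_rename_states, simp add: rename_states_def)
  qed
  then have "decides (rename_states M) L"
    unfolding decides_def by blast
  moreover have "scanned_cells (rename_states M) w t = scanned_cells M w t" for w t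
    by (simp add: scanned_cells_def run_rename_states) (simp add: rename_states_def)
  ultimately show ?thesis
    using tm_wf_rename_states[OF assms(1)] assms(3) unfolding PSPACE_def
    by (intro CollectI exI[of _ "rename_states M"] exI[of _ p]) simp
qed

text \<open>\<open>ok\<close> is demanded of the configuration that is left, so runs compose without
  side conditions and only the last configuration is checked separately.\<close>

definition bounded_step :: "('q, 'a) tm \<Rightarrow> (('q, 'a) config \<Rightarrow> bool) \<Rightarrow> ('q, 'a) config \<Rightarrow> ('q, 'a) config \<Rightarrow> bool" where
  "bounded_step M ok c c' \<longleftrightarrow> ok c \<and> c' = step M c"

text \<open>By determinism the given path is the actual run; from the fixed point \<open>c\<close>
  on the run is constant, so a bound along the path holds at all times.\<close>

lemma bounded_run:
  assumes "(bounded_step M ok)\<^sup>*\<^sup>* (init M w) c" "ok c" "step M c = c"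
  shows "(\<exists>t. run M w t = c) \<and> (\<forall>t. ok (run M w t))"
proof -
  have "\<exists>T. (step M ^^ T) c0 = c \<and> (\<forall>t<T. ok ((step M ^^ t) c0))"
    if "(bounded_step M ok)\<^sup>*\<^sup>* c0 c" for c0
    using that
  proof (induction rule: rtranclp_induct)
    case base
    show ?case by (rule exI[of _ 0]) simp
  next
    case (step y z)
    then obtain T where "(step M ^^ T) c0 = y" "\<forall>t<T. ok ((step M ^^ t) c0)" by blast
    with step.hyps show ?case
      by (intro exI[of _ "Suc T"]) (auto simp: bounded_step_def less_Suc_eq)
  qed
  from this[OF assms(1)] obtain T where T: "run M w T = c" "\<And>t. t < T \<Longrightarrow> ok (run M w t)"
    by (auto simp: run_def)
  have "run M w (T + k) = c" for k
    by (induction k) (use T(1) assms(3) in \<open>auto simp: run_def\<close>)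
  then have "ok (run M w t)" for t
    using T(2)[of t] assms(2) by (metis le_add_diff_inverse not_less)
  with T(1) show ?thesis by blast
qed

section \<open>Factorization trees\<close>

text \<open>Leaves may occur at any level, so \<open>d\<close> bounds the height instead of fixing
  it. Confining the factors to a finite \<open>V\<close> is what makes an exhaustive search
  possible.\<close>

fun split_tree :: "('b \<Rightarrow> 'b \<Rightarrow> 'b) \<Rightarrow> 'b set \<Rightarrow> 'b set \<Rightarrow> nat \<Rightarrow> 'b \<Rightarrow> bool" where
  "split_tree f V A 0 x \<longleftrightarrow> x \<in> A"
| "split_tree f V A (Suc d) x \<longleftrightarrow>
     x \<in> A \<or> (\<exists>y\<in>V. \<exists>z\<in>V. f y z = x \<and> split_tree f V A d y \<and> split_tree f V A d z)"

lemma split_tree_imp_generated: "split_tree f V A d x \<Longrightarrow> x \<in> generated f A"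
  by (induction d arbitrary: x) (auto intro: generated.intros)

text \<open>A semigroup need not have a unit, so a nonempty product is written
  \<open>foldl f a ws\<close> with its first factor apart; by this law such products are cut and
  joined.\<close>

lemma foldl_split:
  assumes "\<And>x y z. f (f x y) z = f x (f y z)"
  shows "foldl f (f a b) ws = f a (foldl f b ws)"
  by (induction ws arbitrary: b) (auto simp: assms)

lemma foldl_closed:
  assumes "A \<subseteq> V" "\<And>x y. x \<in> V \<Longrightarrow> y \<in> V \<Longrightarrow> f x y \<in> V" "a \<in> V" "set ws \<subseteq> A"
  shows "foldl f a ws \<in> V"
  using assms(3,4) by (induction ws arbitrary: a) (use assms(1,2) in auto)

lemma foldl_short:
  assumes fin: "finite V" and AV: "A \<subseteq> V"
    and cl: "\<And>x y. x \<in> V \<Longrightarrow> y \<in> V \<Longrightarrow> f x y \<in> V"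
    and "a \<in> A" "set ws \<subseteq> A"
  obtains vs where "set vs \<subseteq> A" "foldl f a vs = foldl f a ws" "length vs < card V"
proof -
  have "\<exists>vs. set vs \<subseteq> A \<and> foldl f a vs = foldl f a ws \<and> length vs < card V"
    using \<open>set ws \<subseteq> A\<close>
  proof (induction ws rule: length_induct)
    case (1 ws)
    show ?case
    proof (cases "length ws < card V")
      case True
      with 1 show ?thesis by blast
    next
      case False
      let ?g = "\<lambda>i. foldl f a (take i ws)"
      have "?g ` {..length ws} \<subseteq> V"
        using 1(2) \<open>a \<in> A\<close> AV
        by (intro image_subsetI foldl_closed[where A = A] cl) (auto dest: in_set_takeD)
      then have "card (?g ` {..length ws}) < card {..length ws}"
        using False card_mono[OF fin, of "?g ` {..length ws}"] by simp
      then have "\<not> inj_on ?g {..length ws}"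
        using pigeonhole by blast
      then obtain i j where ij: "i < j" "j \<le> length ws" "?g i = ?g j"
        unfolding inj_on_def by (metis atMost_iff linorder_neqE_nat)
      \<comment> \<open>The factors between two equal partial products can be cut out, because the
        fold goes on from the same value.\<close>
      let ?us = "take i ws @ drop j ws"
      have "foldl f a ?us = foldl f a (take j ws @ drop j ws)"
        using ij(3) by (simp only: foldl_append)
      then have "foldl f a ?us = foldl f a ws" by simp
      moreover have "length ?us < length ws" "set ?us \<subseteq> A"
        using ij 1(2) by (auto dest: in_set_takeD in_set_dropD)
      ultimately show ?thesis using 1(1) by metis
    qed
  qed
  with that show thesis by blast
qed

lemma split_tree_foldl:
  assumes assoc: "\<And>x y z. f (f x y) z = f x (f y z)"
    and AV: "A \<subseteq> V" and cl: "\<And>x y. x \<in> V \<Longrightarrow> y \<in> V \<Longrightarrow> f x y \<in> V"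
    and "a \<in> A" "set ws \<subseteq> A" "length ws < 2 ^ d"
  shows "split_tree f V A d (foldl f a ws)"
  using assms(4-)
proof (induction d arbitrary: a ws)
  case 0
  then show ?case by simp
next
  case (Suc d)
  show ?case
  proof (cases "ws = []")
    case True
    with Suc show ?thesis by simp
  next
    case False
    \<comment> \<open>Counting \<open>a\<close> there are \<open>length ws + 1\<close> factors. The
      second half starts with \<open>ws ! h\<close>, so the lists behind the two leading factors
      have lengths \<open>h\<close> and \<open>length ws - Suc h\<close>, both at most half of
      \<open>length ws\<close>.\<close>
    define h where "h = (length ws - 1) div 2"
    have h: "h < length ws" "h < 2 ^ d" "length ws - Suc h < 2 ^ d"
      using False Suc.prems(3) unfolding h_def by (cases ws; auto)+
    have split: "ws = take h ws @ ws ! h # drop (Suc h) ws"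
      using h(1) by (rule id_take_nth_drop)
    have sub: "set (take h ws) \<subseteq> A" "ws ! h \<in> A" "set (drop (Suc h) ws) \<subseteq> A"
      using Suc.prems(2) h(1) by (auto dest: in_set_takeD in_set_dropD)
    let ?y = "foldl f a (take h ws)" and ?z = "foldl f (ws ! h) (drop (Suc h) ws)"
    have "foldl f a ws = f ?y ?z"
      by (subst split) (simp add: foldl_split assoc)
    moreover have "?y \<in> V" "?z \<in> V"
      using sub Suc.prems(1) AV by (auto intro!: foldl_closed[where A = A] cl)
    moreover have "split_tree f V A d ?y" "split_tree f V A d ?z"
      using sub Suc.prems(1) h by (auto intro!: Suc.IH)
    ultimately show ?thesis by auto
  qed
qed

lemma generated_imp_foldl:
  assumes "x \<in> generated f A" and assoc: "\<And>x y z. f (f x y) z = f x (f y z)"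
  shows "\<exists>a ws. a \<in> A \<and> set ws \<subseteq> A \<and> x = foldl f a ws"
  using assms(1)
proof induction
  case (gen x)
  then show ?case by (intro exI[of _ x] exI[of _ "[]"]) simp
next
  case (mult x y)
  then obtain a ws b vs where "a \<in> A" "set ws \<subseteq> A" "x = foldl f a ws"
    "b \<in> A" "set vs \<subseteq> A" "y = foldl f b vs" by blast
  then show ?case
    by (intro exI[of _ a] exI[of _ "ws @ b # vs"]) (simp add: foldl_split assoc)
qed

text \<open>
  An element has a shortest product of at most \<open>card V\<close> generators, since the partial products
  of such a product are distinct; halving it repeatedly gives a tree of logarithmic height.
\<close>

lemma split_tree_iff_generated:
  assumes "finite V" "A \<subseteq> V" "\<And>x y. x \<in> V \<Longrightarrow> y \<in> V \<Longrightarrow> f x y \<in> V"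
    and assoc: "\<And>x y z. f (f x y) z = f x (f y z)"
    and "card V \<le> 2 ^ d"
  shows "split_tree f V A d x \<longleftrightarrow> x \<in> generated f A"
proof
  assume "x \<in> generated f A"
  then obtain a ws where "a \<in> A" "set ws \<subseteq> A" "x = foldl f a ws"
    using generated_imp_foldl[OF _ assoc] by metis
  moreover from this assms(1-3) obtain vs
    where "set vs \<subseteq> A" "foldl f a vs = foldl f a ws" "length vs < card V"
    using foldl_short[of V A f a ws] by metis
  ultimately show "split_tree f V A d x"
    using split_tree_foldl[of f A V a vs d] assms by auto
qed (rule split_tree_imp_generated)

text \<open>The test y z = x is local: on a frame \<open>zip xs ps\<close> it can be done cell by
  cell, in any order.\<close>

lemma map2_eq_iff_zip:
  "length ps = length xs \<Longrightarrow>
    map2 f (map fst ps) (map snd ps) = xs \<longleftrightarrow> (\<forall>(x, y, z) \<in> set (zip xs ps). f y z = x)"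
  by (induction ps xs rule: list_induct2) auto

text \<open>Associativity is wanted on all lists, as the lemma on trees asks for it on the whole
  type; \<open>map2\<close> truncates both sides to the shortest list.\<close>

lemma map2_assoc:
  assumes "semigroup f"
  shows "map2 f (map2 f xs ys) zs = map2 f xs (map2 f ys zs)"
proof (induction xs arbitrary: ys zs)
  case (Cons x xs)
  then show ?case
    using semigroup.assoc[OF assms] by (cases ys; cases zs) auto
qed simp

section \<open>An odometer on tuples\<close>

definition index :: "'a::finite \<Rightarrow> nat" where
  "index = (SOME f. bij_betw f UNIV {0..<CARD('a)})"

lemma bij_index: "bij_betw (index :: 'a::finite \<Rightarrow> nat) UNIV {0..<CARD('a)}"
  unfolding index_def by (rule someI_ex[OF ex_bij_betw_finite_nat[OF finite]])

lemma index_less: "index (p :: 'a::finite) < CARD('a)"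
  using bij_index[where 'a = 'a] by (auto dest: bij_betw_apply)

lemma inj_index: "inj index"
  using bij_index bij_betw_def by blast

definition elem_at :: "nat \<Rightarrow> 'a::finite" where
  "elem_at = inv_into UNIV index"

lemma elem_at_index [simp]: "elem_at (index p) = p"
  by (simp add: elem_at_def inj_index)

lemma index_elem_at: "k < CARD('a) \<Longrightarrow> index (elem_at k :: 'a::finite) = k"
  unfolding elem_at_def using bij_index[where 'a = 'a] by (simp add: bij_betw_def f_inv_into_f)

text \<open>Adds the carry \<open>k\<close> to a number whose least significant digit comes first,
  so that one sweep from left to right suffices; the returned flag is the carry that falls off the
  end.\<close>

fun incr :: "bool \<Rightarrow> 'a::finite list \<Rightarrow> bool \<times> 'a list" where
  "incr k [] = (k, [])"
| "incr k (p # ps) = (if k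
     then if Suc (index p) < CARD('a) then (False, elem_at (Suc (index p)) # ps)
          else apsnd ((#) (elem_at 0)) (incr True ps)
     else (False, p # ps))"

fun num :: "'a::finite list \<Rightarrow> nat" where
  "num [] = 0"
| "num (p # ps) = index p + CARD('a) * num ps"

lemma num_inj: "num ps = num qs \<Longrightarrow> length ps = length qs \<Longrightarrow> ps = qs"
proof (induction ps arbitrary: qs)
  case (Cons p ps)
  then obtain q qs' where qs: "qs = q # qs'" by (cases qs) auto
  with Cons.prems have eq: "index p + CARD('a) * num ps = index q + CARD('a) * num qs'" by simp
  from arg_cong[OF eq, of "\<lambda>m. m mod CARD('a)"] arg_cong[OF eq, of "\<lambda>m. m div CARD('a)"]
  have "index p = index q" "num ps = num qs'"
    by (simp_all add: index_less)
  with Cons qs show ?case using inj_index by (auto dest: injD)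
qed simp

lemma num_less: "num (ps :: 'a::finite list) < CARD('a) ^ length ps"
proof (induction ps)
  case (Cons p ps)
  have "num (p # ps) < CARD('a) * Suc (num ps)" using index_less[of p] by simp
  also have "\<dots> \<le> CARD('a) * CARD('a) ^ length ps"
    using Cons by (intro mult_le_mono2) simp
  finally show ?case by simp
qed simp

lemma length_incr [simp]: "length (snd (incr k ps)) = length ps"
  by (induction k ps rule: incr.induct) auto

lemma num_incr: "\<not> fst (incr True ps) \<Longrightarrow> num (snd (incr True ps)) = Suc (num ps)"
proof (induction ps)
  case (Cons p ps)
  have "Suc (index p) < CARD('a) \<or> Suc (index p) = CARD('a)" using index_less[of p] by linarith
  with Cons show ?case by (auto simp: index_elem_at split: if_splits)
qed simp

text \<open>A carry falls off only when all digits are maximal: the enumeration of the candidates is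
  then exhausted.\<close>

lemma incr_overflow:
  "fst (incr True (ps :: 'a::finite list)) \<Longrightarrow> Suc (num ps) = CARD('a) ^ length ps"
proof (induction ps)
  case (Cons p ps)
  then have "Suc (index p) = CARD('a)" "Suc (num ps) = CARD('a) ^ length ps"
    using index_less[of p] by (auto split: if_splits)
  moreover have "Suc (num (p # ps)) = Suc (index p) + CARD('a) * num ps" by simp
  ultimately show ?case by (metis length_Cons mult_Suc_right power_Suc)
qed simp

lemma num_replicate: "num (replicate n (elem_at 0 :: 'a::finite)) = 0"
  by (induction n) (auto simp: index_elem_at)

section \<open>The machine\<close>

text \<open>
  Tape 0 is the input.  Tape 1 holds the tuple under test; as it has length \<open>n\<close> and is surrounded
  by blanks, it also serves as the ruler that ends every loop over a frame.  Tape 2 is a stack of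
  frames of \<open>n\<close> cells: cell \<open>i\<close> of a frame holds \<open>(x\<^sub>i, y\<^sub>i, z\<^sub>i)\<close>, where \<open>x\<close> is the tuple
  to be factored and \<open>(y, z)\<close> the factorization currently tried.  Tape 3 bounds the depth: its
  head moves left with every push, so that a blank under the head means that no level is left, and a
  blank to its right that the stack is empty.  The cell that a frame occupies there contains
  \<open>Aux 0\<close> while the first factor is tested and \<open>Aux 1\<close> while the second one is.

  In \<open>Scan f e\<close>, \<open>f\<close> says whether the tuple under test equals one of the previous generators,
  and \<open>e\<close> whether it agrees with the current block so far.  As the first block of the input
  is not a generator, \<open>e\<close> is initially false.  Every scan also checks that the input is well-formed.
\<close>

datatype state =
    Load nat | Rewind | Scan bool bool | Scan_Back bool | To_End bool | Return bool
  | Check bool | Second | Pop bool | Push | Copy bool | Next bool | Accept | Reject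

instance state :: countable
  by countable_datatype

definition letter :: "'s \<Rightarrow> 's option symbol" where
  "letter s = Letter (Some s)"

text \<open>The defaults keep the transition function total: even when a junk symbol is decoded,
  what is written is again some \<open>letter s\<close> or \<open>cell t\<close>, hence in the
  alphabet.\<close>

fun unletter :: "'s option symbol \<Rightarrow> 's" where
  "unletter (Letter (Some s)) = s"
| "unletter _ = undefined"

definition cell :: "'s::finite \<times> 's \<times> 's \<Rightarrow> 's option symbol" where
  "cell t = Aux (index t)"

fun uncell :: "'s option symbol \<Rightarrow> 's::finite \<times> 's \<times> 's" where
  "uncell (Aux k) = elem_at k"
| "uncell _ = undefined"

lemma unletter_letter [simp]: "unletter (letter s) = s"
  by (simp add: letter_def)

lemma uncell_cell [simp]: "uncell (cell t) = t"
  by (simp add: cell_def)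

lemma letter_simps [simp]:
  "letter s \<noteq> Blank" "letter s \<noteq> Letter None" "letter s = letter t \<longleftrightarrow> s = t"
  by (auto simp: letter_def)

text \<open>Only a direction is listed for tape 0, because the input is read-only.\<close>

type_synonym 's move =
  "state \<times> direction \<times> ('s option symbol \<times> direction) \<times> ('s option symbol \<times> direction) \<times>
   ('s option symbol \<times> direction)"

text \<open>When a scan is over, the input head steps back from the blank behind the input, which
  \<open>Rewind\<close> would take for the left end. After a negative return,
  \<open>Check False\<close> merely sweeps back to the start of the frame, since it can only end in
  \<open>Next True\<close>; the mark is reset to \<open>Aux 0\<close> because the second factor may
  have been under test.\<close>

fun delta :: "('s::finite \<Rightarrow> 's \<Rightarrow> 's) \<Rightarrow> state \<Rightarrow> 's option symbol \<Rightarrow> 's option symbol \<Rightarrow>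
    's option symbol \<Rightarrow> 's option symbol \<Rightarrow> 's move" where
  "delta mul (Load j) i x s c =
     (if i = Blank \<or> i = Letter None then (Rewind, Left, (x, Left), (s, Stay), (c, Left))
      else if Suc j < CARD('s) then (Load (Suc j), Stay, (x, Stay), (s, Stay), (Aux 0, Right))
      else (Load 0, Right, (i, Right), (s, Stay), (Aux 0, Right)))"
| "delta mul Rewind i x s c =
     (if i = Blank \<and> x = Blank then (Scan False False, Right, (x, Right), (s, Stay), (c, Stay))
      else (Rewind, if i = Blank then Stay else Left, (x, if x = Blank then Stay else Left),
        (s, Stay), (c, Stay)))"
| "delta mul (Scan f e) i x s c =
     (if (x = Blank) \<noteq> (i = Blank \<or> i = Letter None)
      then (Reject, Stay, (x, Stay), (s, Stay), (c, Stay))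
      else if x = Blank then (Scan_Back (f \<or> e), Stay, (x, Left), (s, Stay), (c, Stay))
      else (Scan f (e \<and> x = i), Right, (x, Right), (s, Stay), (c, Stay)))"
| "delta mul (Scan_Back f) i x s c =
     (if x \<noteq> Blank then (Scan_Back f, Stay, (x, Left), (s, Stay), (c, Stay))
      else if i \<noteq> Blank then (Scan f True, Right, (x, Right), (s, Stay), (c, Stay))
      else if f then (To_End True, Left, (x, Right), (s, Stay), (c, Stay))
      else if c = Blank then (To_End False, Left, (x, Right), (s, Stay), (c, Stay))
      else (Push, Left, (x, Right), (s, Stay), (Aux 0, Left)))"
| "delta mul (To_End r) i x s c =
     (if x \<noteq> Blank then (To_End r, Stay, (x, Right), (s, Stay), (c, Stay))
      else (Return r, Stay, (x, Stay), (s, Stay), (c, Right)))"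
| "delta mul (Return r) i x s c =
     (if c = Blank then (if r then Accept else Reject, Stay, (x, Stay), (s, Stay), (c, Stay))
      else if \<not> r then (Check False, Stay, (x, Left), (s, Left), (Aux 0, Left))
      else if c = Aux 0 then (Second, Stay, (x, Left), (s, Left), (Aux 1, Left))
      else (Pop True, Stay, (x, Left), (s, Left), (c, Stay)))"
| "delta mul (Check ok) i x s c =
     (if x \<noteq> Blank
      then (Check (ok \<and> (case uncell s of (x0, y, z) \<Rightarrow> mul y z = x0)),
        Stay, (x, Left), (s, Left), (c, Stay))
      else (if ok then Copy False else Next True, Stay, (x, Right), (s, Right), (c, Stay)))"
| "delta mul Second i x s c =
     (if x \<noteq> Blank then (Second, Stay, (x, Left), (s, Left), (c, Stay))
      else (Copy True, Stay, (x, Right), (s, Right), (c, Stay)))"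
| "delta mul (Pop r) i x s c =
     (if x \<noteq> Blank then (Pop r, Stay, (x, Left), (s, Left), (c, Stay))
      else (To_End r, Stay, (x, Right), (s, Right), (c, Stay)))"
| "delta mul Push i x s c =
     (if x \<noteq> Blank
      then (Push, Stay, (x, Right), (cell (unletter x, elem_at 0), Right), (c, Stay))
      else (Check True, Stay, (x, Left), (s, Left), (c, Stay)))"
| "delta mul (Copy second) i x s c =
     (if x \<noteq> Blank
      then (Copy second, Stay,
        (letter (case uncell s of (x0, y, z) \<Rightarrow> if second then z else y), Right),
        (s, Right), (c, Stay))
      else (Rewind, Stay, (x, Left), (s, Stay), (c, Stay)))"
| "delta mul (Next k) i x s c =
     (if x \<noteq> Blank
      then (case uncell s of (x0, p) \<Rightarrow>
        if \<not> k then (Next False, Stay, (x, Right), (s, Right), (c, Stay))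
        else if Suc (index p) < CARD('s \<times> 's)
        then (Next False, Stay, (x, Right), (cell (x0, elem_at (Suc (index p))), Right), (c, Stay))
        else (Next True, Stay, (x, Right), (cell (x0, elem_at 0), Right), (c, Stay)))
      else if k then (Pop False, Stay, (x, Left), (s, Left), (c, Right))
      else (Check True, Stay, (x, Left), (s, Left), (c, Stay)))"
| "delta mul q i x s c = (Reject, Stay, (x, Stay), (s, Stay), (c, Stay))"

definition machine :: "('s::finite \<Rightarrow> 's \<Rightarrow> 's) \<Rightarrow> (state, 's option) tm" where
  "machine mul =
    \<lparr>tm_tapes = 4,
     tm_states = Load ` {..<CARD('s)} \<union> {Rewind, Second, Push, Accept, Reject} \<union>
       range (\<lambda>(f, e). Scan f e) \<union> range Scan_Back \<union> range To_End \<union> range Return \<union>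
       range Check \<union> range Pop \<union> range Copy \<union> range Next,
     tm_symbols = {Blank} \<union> range Letter \<union> {Aux 0, Aux 1} \<union> range cell,
     tm_start = Load 0, tm_accept = Accept, tm_reject = Reject,
     tm_delta = (\<lambda>q gs. case delta mul q (gs ! 0) (gs ! 1) (gs ! 2) (gs ! 3) of
       (q', di, ax, as, ac) \<Rightarrow> (q', [(gs ! 0, di), ax, as, ac]))\<rparr>"

lemma tm_wf_machine: "tm_wf (machine (mul :: 's::finite \<Rightarrow> 's \<Rightarrow> 's))"
proof -
  let ?M = "machine mul"
  have tapes: "tm_tapes ?M = 4"
    and moves: "tm_delta ?M q gs = (case delta mul q (gs ! 0) (gs ! 1) (gs ! 2) (gs ! 3) of
       (q', di, ax, as, ac) \<Rightarrow> (q', [(gs ! 0, di), ax, as, ac]))" for q gs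
    by (simp_all add: machine_def)
  have states: "q \<in> tm_states ?M \<longleftrightarrow> (case q of Load j \<Rightarrow> j < CARD('s) | _ \<Rightarrow> True)" for q
    by (cases q) (auto simp: machine_def)
  have symbols: "Blank \<in> tm_symbols ?M" "Letter a \<in> tm_symbols ?M" "letter s \<in> tm_symbols ?M"
    "Aux 0 \<in> tm_symbols ?M" "Aux (Suc 0) \<in> tm_symbols ?M" "cell t \<in> tm_symbols ?M" for a s t
    by (simp_all add: machine_def letter_def)
  \<comment> \<open>This holds from every state, even from a \<open>Load j\<close> outside the state
    set: the counter is raised only while it stays below \<open>CARD('s)\<close>.\<close>
  have delta: "case delta mul q i x s c of (q', di, (x', dx), (s', ds), (c', dc)) \<Rightarrow>
      q' \<in> tm_states ?M \<and> {x', s', c'} \<subseteq> tm_symbols ?M"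
    if "{i, x, s, c} \<subseteq> tm_symbols ?M" for q i x s c
    using that by (cases q) (simp_all add: states symbols case_prod_beta)
  have trans: "case tm_delta ?M q gs of (q', as) \<Rightarrow>
      q' \<in> tm_states ?M \<and> length as = tm_tapes ?M \<and> fst ` set as \<subseteq> tm_symbols ?M"
    if "length gs = tm_tapes ?M" "set gs \<subseteq> tm_symbols ?M" for q gs
  proof -
    have "length gs = 4" using that by (simp add: machine_def)
    then obtain i x s c where gs: "gs = [i, x, s, c]"
      by (auto simp: numeral_eq_Suc length_Suc_conv)
    then show ?thesis
      using delta[of i x s c q] that(2) by (simp add: tapes moves case_prod_beta)
  qed
  have "\<forall>q \<in> tm_states ?M - {tm_accept ?M, tm_reject ?M}. \<forall>gs.
      length gs = tm_tapes ?M \<and> set gs \<subseteq> tm_symbols ?M \<longrightarrow>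
      (case tm_delta ?M q gs of (q', as) \<Rightarrow>
        q' \<in> tm_states ?M \<and> length as = tm_tapes ?M \<and> fst ` set as \<subseteq> tm_symbols ?M)"
    by (intro ballI allI impI trans) simp_all
  moreover have "finite (tm_states ?M)" "finite (tm_symbols ?M)" "1 \<le> tm_tapes ?M"
    "{tm_start ?M, tm_accept ?M, tm_reject ?M} \<subseteq> tm_states ?M" "tm_accept ?M \<noteq> tm_reject ?M"
    "insert Blank (range Letter) \<subseteq> tm_symbols ?M"
    by (auto simp: machine_def)
  ultimately show ?thesis
    unfolding tm_wf_def by (intro conjI)
qed

section \<open>Loops of the machine\<close>

primrec holds :: "(int \<Rightarrow> 'c) \<Rightarrow> int \<Rightarrow> 'c list \<Rightarrow> bool" where
  "holds F p [] \<longleftrightarrow> True"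
| "holds F p (g # gs) \<longleftrightarrow> F p = g \<and> holds F (p + 1) gs"

lemma holds_append [simp]:
  "holds F p (gs @ hs) \<longleftrightarrow> holds F p gs \<and> holds F (p + int (length gs)) hs"
  by (induction gs arbitrary: p) (auto simp: algebra_simps)

lemma holds_cong:
  "\<lbrakk>holds F p gs; \<And>i. p \<le> i \<Longrightarrow> i < p + int (length gs) \<Longrightarrow> F' i = F i\<rbrakk> \<Longrightarrow> holds F' p gs"
  by (induction gs arbitrary: p) auto

lemma holds_nth: "holds F p gs \<longleftrightarrow> (\<forall>i < length gs. F (p + int i) = gs ! i)"
proof (induction gs arbitrary: p)
  case (Cons g gs)
  show ?case
    unfolding holds.simps Cons by (auto simp: nth_Cons less_Suc_eq_0_disj algebra_simps split: nat.splits)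
qed simp

text \<open>Says which cells are nonblank and leaves open what they hold: the ruler on tape 1 and
  the counter on tape 3 work through their blank borders.\<close>

definition filled :: "nat \<Rightarrow> (int \<Rightarrow> 'c symbol) \<Rightarrow> bool" where
  "filled m X \<longleftrightarrow> (\<forall>i. X i = Blank \<longleftrightarrow> \<not> (0 \<le> i \<and> i < int m))"

lemma filled_iff: "filled m X \<Longrightarrow> X i = Blank \<longleftrightarrow> i < 0 \<or> int m \<le> i"
  unfolding filled_def by (drule spec[of _ i]) linarith

lemma filledD:
  "filled m X \<Longrightarrow> 0 \<le> i \<Longrightarrow> i < int m \<Longrightarrow> X i \<noteq> Blank"
  "filled m X \<Longrightarrow> i < 0 \<Longrightarrow> X i = Blank"
  "filled m X \<Longrightarrow> int m \<le> i \<Longrightarrow> X i = Blank"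
  by (auto simp: filled_def)

lemma filled_upd: "filled m X \<Longrightarrow> 0 \<le> i \<Longrightarrow> i < int m \<Longrightarrow> g \<noteq> Blank \<Longrightarrow> filled m (X(i := g))"
  by (auto simp: filled_def)

lemma filled_extend: "filled m X \<Longrightarrow> g \<noteq> Blank \<Longrightarrow> filled (Suc m) (X(int m := g))"
  unfolding filled_def by (intro allI, drule_tac x = i in spec) auto

lemma holds_upd: "holds F p gs \<Longrightarrow> i < p \<or> p + int (length gs) \<le> i \<Longrightarrow> holds (F(i := g)) p gs"
  by (erule holds_cong) auto

lemma filled_input: "filled (length w) (fst (input_tape w))"
  by (auto simp: filled_def input_tape_def)

lemma holds_input: "holds (fst (input_tape w)) 0 (map Letter w)"
  by (auto simp: holds_nth input_tape_def)

text \<open>The lengths of \<open>b\<close> and of the members of \<open>as\<close> are unrelated,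
  so malformed words are treated in the same setting.\<close>

locale smp_run =
  fixes mul :: "'s::finite \<Rightarrow> 's \<Rightarrow> 's" and as :: "'s list list" and b :: "'s list"
begin

definition "n = length b"
definition "w = encode (n, as, b)"
definition "N = length w"
text \<open>\<open>D\<close> is the number of levels, one for each mark on tape 3; \<open>P\<close>
  is the room for \<open>D\<close> frames of \<open>n\<close> cells.\<close>

definition "D = CARD('s) * n"
definition "P = D * n"
definition "I = fst (input_tape w)"

definition cfg where
  "cfg q hi X hx F hs G hc = (q, [(I, hi), (X, hx), (F, hs), (G, hc)])"

text \<open>One cell beyond either end of each region is allowed, because loops end by stepping onto
  a blank.\<close>

definition ok :: "(state, 's option) config \<Rightarrow> bool" where
  "ok c \<longleftrightarrow> list_all2 (\<lambda>t m. - 1 \<le> snd t \<and> snd t \<le> int m) (snd c) [N, n, P, D]"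

abbreviation reach (infix "\<leadsto>" 50) where
  "c \<leadsto> c' \<equiv> (bounded_step (machine mul) ok)\<^sup>*\<^sup>* c c'"

definition rejects where
  "rejects c \<longleftrightarrow> (\<exists>c'. c \<leadsto> c' \<and> ok c' \<and> fst c' = Reject)"

lemma ok_cfg [simp]:
  "ok (cfg q hi X hx F hs G hc) \<longleftrightarrow>
     - 1 \<le> hi \<and> hi \<le> int N \<and> - 1 \<le> hx \<and> hx \<le> int n \<and> - 1 \<le> hs \<and> hs \<le> int P \<and>
     - 1 \<le> hc \<and> hc \<le> int D"
  by (auto simp: ok_def cfg_def)

lemma fst_cfg [simp]: "fst (cfg q hi X hx F hs G hc) = q"
  by (simp add: cfg_def)

fun moved where
  "moved (q, di, (x, dx), (s, ds), (c, dc)) hi X hx F hs G hc =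
    cfg q (hi + shift di) (X(hx := x)) (hx + shift dx) (F(hs := s)) (hs + shift ds)
      (G(hc := c)) (hc + shift dc)"

lemma step_cfg:
  assumes "q \<noteq> Accept" "q \<noteq> Reject"
  shows "step (machine mul) (cfg q hi X hx F hs G hc) =
    moved (delta mul q (I hi) (X hx) (F hs) (G hc)) hi X hx F hs G hc"
  using assms by (simp add: machine_def cfg_def split: prod.splits)

declare fun_upd_idem [simp]

lemma reach_refl [simp]: "c \<leadsto> c"
  by simp

text \<open>Used backwards, this executes the machine symbolically by one step and leaves the rest
  of the run as a goal.\<close>

lemma reach_step:
  assumes "q \<noteq> Accept" "q \<noteq> Reject" "ok (cfg q hi X hx F hs G hc)"
    and "moved (delta mul q (I hi) (X hx) (F hs) (G hc)) hi X hx F hs G hc \<leadsto> c"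
  shows "cfg q hi X hx F hs G hc \<leadsto> c"
  using assms by (intro converse_rtranclp_into_rtranclp[OF _ assms(4)])
    (simp add: bounded_step_def step_cfg)

lemma rejects_reach: "c \<leadsto> c' \<Longrightarrow> rejects c' \<Longrightarrow> rejects c"
  unfolding rejects_def by (meson rtranclp_trans)

section \<open>Rewinding and scanning the input\<close>

lemma filled_I: "filled N I"
  by (simp add: N_def I_def filled_input)

lemma holds_I: "holds I 0 (map Letter w)"
  by (simp add: I_def holds_input)

lemma rejectsI: "c \<leadsto> cfg Reject hi X hx F hs G hc \<Longrightarrow> ok (cfg Reject hi X hx F hs G hc) \<Longrightarrow> rejects c"
  unfolding rejects_def by (metis fst_cfg)

abbreviation "in_range hi hs hc \<equiv>
  - 1 \<le> hi \<and> hi \<le> int N \<and> - 1 \<le> hs \<and> hs \<le> int P \<and> - 1 \<le> hc \<and> hc \<le> int D"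

text \<open>A head that has reached its blank waits for the other, so the sum of the two distances
  decreases. Both heads must start left of the right border, whose blank would be mistaken for the
  left one.\<close>

lemma rewind:
  assumes "filled n X" "- 1 \<le> hi" "hi < int N" "- 1 \<le> hx" "hx < int n" "in_range hi hs hc"
  shows "cfg Rewind hi X hx F hs G hc \<leadsto> cfg (Scan False False) 0 X 0 F hs G hc"
  using assms
proof (induction "nat (hi + 1) + nat (hx + 1)" arbitrary: hi hx rule: less_induct)
  case less
  have I: "I hi = Blank \<longleftrightarrow> hi = - 1" and X: "X hx = Blank \<longleftrightarrow> hx = - 1"
    using less.prems(2-5) filled_iff[OF filled_I, of hi] filled_iff[OF less.prems(1), of hx] by auto
  show ?case
  proof (cases "hi = - 1 \<and> hx = - 1")
    case True
    then show ?thesis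
      using less.prems I X by (intro reach_step) auto
  next
    case False
    then consider "hi = - 1" "hx \<noteq> - 1" | "hi \<noteq> - 1" "hx = - 1" | "hi \<noteq> - 1" "hx \<noteq> - 1"
      by blast
    then show ?thesis
    proof cases
      case 1
      have "cfg Rewind hi X (hx - 1) F hs G hc \<leadsto> cfg (Scan False False) 0 X 0 F hs G hc"
        using less.prems 1 by (intro less.hyps) auto
      then show ?thesis
        by (intro reach_step) (use less.prems I X 1 in simp_all)
    next
      case 2
      have "cfg Rewind (hi - 1) X hx F hs G hc \<leadsto> cfg (Scan False False) 0 X 0 F hs G hc"
        using less.prems 2 by (intro less.hyps) auto
      then show ?thesis
        by (intro reach_step) (use less.prems I X 2 in simp_all)
    next
      case 3
      have "cfg Rewind (hi - 1) X (hx - 1) F hs G hc \<leadsto> cfg (Scan False False) 0 X 0 F hs G hc"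
        using less.prems 3 by (intro less.hyps) auto
      then show ?thesis
        by (intro reach_step) (use less.prems I X 3 in simp_all)
    qed
  qed
qed

lemma to_end:
  assumes "filled n X" "0 \<le> hx" "hx \<le> int n" "in_range hi hs hc"
  shows "cfg (To_End r) hi X hx F hs G hc \<leadsto> cfg (Return r) hi X (int n) F hs G (hc + 1)"
  using assms(2,3)
proof (induction "nat (int n - hx)" arbitrary: hx)
  case 0
  then have "hx = int n" by simp
  with assms show ?case
    by (intro reach_step) (auto simp: filledD)
next
  case (Suc k)
  have "cfg (To_End r) hi X (hx + 1) F hs G hc \<leadsto> cfg (Return r) hi X (int n) F hs G (hc + 1)"
    using Suc by auto
  then show ?case
    using Suc assms by (intro reach_step) (auto simp: filledD)
qed

lemma scan_back:
  assumes "filled n X" "- 1 \<le> hx" "hx < int n" "in_range hi hs hc"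
  shows "cfg (Scan_Back f) hi X hx F hs G hc \<leadsto> cfg (Scan_Back f) hi X (- 1) F hs G hc"
  using assms(2,3)
proof (induction "nat (hx + 1)" arbitrary: hx)
  case 0
  then have "hx = - 1" by simp
  then show ?case by simp
next
  case (Suc k)
  have "cfg (Scan_Back f) hi X (hx - 1) F hs G hc \<leadsto> cfg (Scan_Back f) hi X (- 1) F hs G hc"
    using Suc by auto
  then show ?case
    using Suc assms by (intro reach_step) (auto simp: filledD)
qed

text \<open>The flag \<open>e\<close> carries the verdict on the letters already compared, which
  frees the induction on the rest \<open>a\<close> of the block. If the lengths differ, one head
  meets the end of its word before the other, and the machine rejects.\<close>

lemma scan_block:
  assumes "filled n X" "in_range hi hs hc"
    and "holds X hx (map letter xs)" "0 \<le> hx" "hx + int (length xs) = int n"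
    and "holds I hi (map letter a)" "hi + int (length a) \<le> int N"
    and "I (hi + int (length a)) = Blank \<or> I (hi + int (length a)) = Letter None"
  shows "if length a = length xs
    then cfg (Scan f e) hi X hx F hs G hc \<leadsto>
      cfg (Scan_Back (f \<or> e \<and> a = xs)) (hi + int (length a)) X (- 1) F hs G hc
    else rejects (cfg (Scan f e) hi X hx F hs G hc)"
  using assms(2-)
proof (induction a arbitrary: xs hi hx e)
  case Nil
  show ?case
  proof (cases xs)
    case [simp]: Nil
    have "cfg (Scan_Back (f \<or> e)) hi X (hx - 1) F hs G hc \<leadsto>
        cfg (Scan_Back (f \<or> e)) hi X (- 1) F hs G hc"
      using Nil.prems by (intro scan_back assms(1)) auto
    then have "cfg (Scan f e) hi X hx F hs G hc \<leadsto> cfg (Scan_Back (f \<or> e)) hi X (- 1) F hs G hc"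
      using Nil.prems by (intro reach_step) (auto simp: filledD[OF assms(1)])
    then show ?thesis by simp
  next
    case (Cons x xs')
    then have "cfg (Scan f e) hi X hx F hs G hc \<leadsto> cfg Reject hi X hx F hs G hc"
      using Nil.prems by (intro reach_step) auto
    with Cons Nil.prems show ?thesis
      by (auto intro: rejectsI)
  qed
next
  case (Cons s a)
  show ?case
  proof (cases xs)
    case Nil
    have "cfg (Scan f e) hi X hx F hs G hc \<leadsto> cfg Reject hi X hx F hs G hc"
      using Cons.prems Nil by (intro reach_step) (auto simp: filledD[OF assms(1)])
    with Cons Nil show ?thesis
      by (auto intro: rejectsI)
  next
    case [simp]: (Cons x xs')
    let ?c = "cfg (Scan f (e \<and> x = s)) (hi + 1) X (hx + 1) F hs G hc"
    have go: "cfg (Scan f e) hi X hx F hs G hc \<leadsto> ?c"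
      using Cons.prems by (intro reach_step) auto
    have "if length a = length xs'
      then ?c \<leadsto> cfg (Scan_Back (f \<or> (e \<and> x = s) \<and> a = xs')) (hi + 1 + int (length a)) X (- 1) F hs G hc
      else rejects ?c"
      using Cons.prems by (intro Cons.IH) (auto simp: algebra_simps)
    with go show ?thesis
      by (auto simp: algebra_simps eq_commute[of s x] intro: rejects_reach elim: rtranclp_trans
          split: if_splits)
  qed
qed

lemma encode_Cons: "encode (m, c # cs, a) = map Some a @ None # encode (m, cs, c)"
  by simp

text \<open>The current block \<open>a\<close> counts as a generator only if \<open>e\<close> held
  on entering it; this keeps the target, scanned with \<open>e\<close> false, out of the
  comparison.\<close>

lemma scan_blocks:
  assumes "filled n X" "holds X 0 (map letter xs)" "length xs = n" "in_range hi hs hc"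
    and "holds I hi (map Letter (encode (m, cs, a)))" "0 \<le> hi"
      "hi + int (length (encode (m, cs, a))) = int N"
  shows "if \<forall>c \<in> set (a # cs). length c = n
    then cfg (Scan f e) hi X 0 F hs G hc \<leadsto>
      cfg (Scan_Back (f \<or> e \<and> a = xs \<or> xs \<in> set cs)) (int N) X (- 1) F hs G hc
    else rejects (cfg (Scan f e) hi X 0 F hs G hc)"
  using assms(4-)
proof (induction cs arbitrary: a hi f e)
  case Nil
  have hi: "hi + int (length a) = int N" using Nil.prems by simp
  have "if length a = length xs
    then cfg (Scan f e) hi X 0 F hs G hc \<leadsto>
      cfg (Scan_Back (f \<or> e \<and> a = xs)) (hi + int (length a)) X (- 1) F hs G hc
    else rejects (cfg (Scan f e) hi X 0 F hs G hc)"
    using Nil.prems assms(1-3) filledD(3)[OF filled_I, of "hi + int (length a)"]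
    by (intro scan_block) (auto simp: letter_def[abs_def] comp_def)
  with hi assms(3) show ?case by auto
next
  case (Cons c cs)
  let ?hi = "hi + int (length a)"
  have I: "holds I hi (map letter a)" "I ?hi = Letter None"
    "holds I (?hi + 1) (map Letter (encode (m, cs, c)))"
    using Cons.prems(2) by (simp_all only: encode_Cons map_append holds_append list.map holds.simps
      length_map letter_def[abs_def] map_map comp_def simp_thms)
  have N: "?hi + 1 + int (length (encode (m, cs, c))) = int N"
    using Cons.prems(4) by (simp only: encode_Cons) simp
  have block: "if length a = length xs
    then cfg (Scan f e) hi X 0 F hs G hc \<leadsto>
      cfg (Scan_Back (f \<or> e \<and> a = xs)) ?hi X (- 1) F hs G hc
    else rejects (cfg (Scan f e) hi X 0 F hs G hc)"
    using Cons.prems assms(1-3) I N by (intro scan_block) auto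
  show ?case
  proof (cases "length a = n")
    case True
    let ?f = "f \<or> e \<and> a = xs" and ?h = "?hi + 1"
    have "cfg (Scan_Back ?f) ?hi X (- 1) F hs G hc \<leadsto> cfg (Scan ?f True) ?h X 0 F hs G hc"
      using Cons.prems(1,3) I(2) N by (intro reach_step) (auto simp: filledD[OF assms(1)])
    with block True assms(3) have go:
      "cfg (Scan f e) hi X 0 F hs G hc \<leadsto> cfg (Scan ?f True) ?h X 0 F hs G hc"
      by (auto elim: rtranclp_trans)
    have "if \<forall>c \<in> set (c # cs). length c = n
      then cfg (Scan ?f True) ?h X 0 F hs G hc \<leadsto>
        cfg (Scan_Back (?f \<or> True \<and> c = xs \<or> xs \<in> set cs)) (int N) X (- 1) F hs G hc
      else rejects (cfg (Scan ?f True) ?h X 0 F hs G hc)"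
      using Cons.prems I N by (intro Cons.IH) auto
    \<comment> \<open>A block behind a separator is entered with \<open>e\<close> true, so
      \<open>c\<close> joins the generators.\<close>
    moreover have "(?f \<or> True \<and> c = xs \<or> xs \<in> set cs) \<longleftrightarrow> (f \<or> e \<and> a = xs \<or> xs \<in> set (c # cs))"
      by auto
    ultimately show ?thesis
      using go True by (auto intro: rejects_reach elim: rtranclp_trans split: if_splits)
  next
    case False
    with block assms(3) show ?thesis by auto
  qed
qed

section \<open>Sweeps over the top frame of the stack\<close>

lemma reach_trans: "c \<leadsto> c' \<Longrightarrow> c' \<leadsto> c'' \<Longrightarrow> c \<leadsto> c''"
  by (rule rtranclp_trans)

text \<open>Stated for any state with this transition pattern, so that it serves both
  \<open>Second\<close> and \<open>Pop\<close>.\<close>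

lemma sweep_left:
  assumes delta: "\<And>i x s c. delta mul q i x s c =
      (if x \<noteq> Blank then (q, Stay, (x, Left), (s, Left), (c, Stay))
       else (q', Stay, (x, Right), (s, Right), (c, Stay)))" "q \<noteq> Accept" "q \<noteq> Reject"
    and "filled n X" "in_range hi p hc" "0 \<le> p" "p + int m \<le> int P" "m \<le> n"
  shows "cfg q hi X (int m - 1) F (p + int m - 1) G hc \<leadsto> cfg q' hi X 0 F p G hc"
  using assms(7,8)
proof (induction m)
  case 0
  then show ?case
    by (intro reach_step) (use assms in \<open>simp_all add: filled_iff\<close>)
next
  case (Suc m)
  then have "cfg q hi X (int m - 1) F (p + int m - 1) G hc \<leadsto> cfg q' hi X 0 F p G hc"
    by simp
  then show ?case
    by (intro reach_step) (use assms Suc.prems in \<open>simp_all add: filled_iff\<close>)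
qed

lemma sweep_Check:
  assumes "filled n X" "in_range hi p hc" "0 \<le> p" "p + int (length ts) \<le> int P" "length ts \<le> n"
    and "holds F p (map cell ts)"
  shows "cfg (Check k) hi X (int (length ts) - 1) F (p + int (length ts) - 1) G hc \<leadsto>
    cfg (if k \<and> (\<forall>(x, y, z) \<in> set ts. mul y z = x) then Copy False else Next True) hi X 0 F p G hc"
  using assms(4-)
proof (induction ts arbitrary: k rule: rev_induct)
  case Nil
  then show ?case
    by (intro reach_step) (use assms in \<open>simp_all add: filled_iff\<close>)
next
  case (snoc t ts)
  obtain x y z where t: "t = (x, y, z)" by (cases t)
  have "cfg (Check (k \<and> mul y z = x)) hi X (int (length ts) - 1) F (p + int (length ts) - 1) G hc \<leadsto>
    cfg (if (k \<and> mul y z = x) \<and> (\<forall>(x, y, z) \<in> set ts. mul y z = x) then Copy False else Next True)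
      hi X 0 F p G hc"
    using snoc.prems by (intro snoc.IH) auto
  moreover have "((k \<and> mul y z = x) \<and> (\<forall>(x, y, z) \<in> set ts. mul y z = x)) \<longleftrightarrow>
      k \<and> (\<forall>(x, y, z) \<in> set (ts @ [t]). mul y z = x)"
    using t by auto
  ultimately show ?case
    using t by (intro reach_step) (use assms(1-3) snoc.prems in \<open>simp_all add: filled_iff\<close>)
qed

text \<open>Only the cells below the new frame are guaranteed to survive; those above it may hold
  remains of popped frames.\<close>

lemma sweep_Push:
  assumes "filled n X" "in_range hi hs hc" "0 \<le> hs" "hs + int (length xs) \<le> int P"
    and "holds X hx (map letter xs)" "0 \<le> hx" "hx + int (length xs) = int n"
  shows "\<exists>F'. cfg Push hi X hx F hs G hc \<leadsto>
      cfg (Check True) hi X (int n - 1) F' (hs + int (length xs) - 1) G hc \<and>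
    (\<forall>i<hs. F' i = F i) \<and> holds F' hs (map (\<lambda>x. cell (x, elem_at 0)) xs)"
  using assms(2-)
proof (induction xs arbitrary: hx hs F)
  case Nil
  have "cfg Push hi X hx F hs G hc \<leadsto> cfg (Check True) hi X (int n - 1) F (hs - 1) G hc"
    by (intro reach_step) (use Nil assms(1) in \<open>simp_all add: filled_iff\<close>)
  then show ?case by auto
next
  case (Cons x xs)
  let ?F = "F(hs := cell (x, elem_at 0))"
  have "\<exists>F'. cfg Push hi X (hx + 1) ?F (hs + 1) G hc \<leadsto>
      cfg (Check True) hi X (int n - 1) F' (hs + 1 + int (length xs) - 1) G hc \<and>
      (\<forall>i<hs + 1. F' i = ?F i) \<and>
      holds F' (hs + 1) (map (\<lambda>x. cell (x, elem_at 0)) xs)"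
    by (rule Cons.IH) (use Cons.prems in auto)
  then obtain F' where F': "cfg Push hi X (hx + 1) ?F (hs + 1) G hc \<leadsto>
      cfg (Check True) hi X (int n - 1) F' (hs + 1 + int (length xs) - 1) G hc"
    "\<forall>i<hs + 1. F' i = ?F i" "holds F' (hs + 1) (map (\<lambda>x. cell (x, elem_at 0)) xs)"
    by blast
  have "cfg Push hi X hx F hs G hc \<leadsto>
      cfg (Check True) hi X (int n - 1) F' (hs + 1 + int (length xs) - 1) G hc"
    by (rule reach_step) (use F'(1) Cons.prems in simp_all)
  with F'(2,3) show ?case
    by (intro exI[of _ F']) (auto simp: algebra_simps)
qed

definition factor :: "bool \<Rightarrow> 's \<times> 's \<Rightarrow> 's" where
  "factor second p = (if second then snd p else fst p)"

text \<open>Tape 1 is overwritten in place and never blanked, so it remains a ruler of length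
  \<open>n\<close>.\<close>

lemma sweep_Copy:
  assumes "filled n X" "in_range hi hs hc" "0 \<le> hs" "hs + int (length xs) \<le> int P"
    and "holds F hs (map cell (zip xs ps))" "length ps = length xs"
    and "0 \<le> hx" "hx + int (length xs) = int n"
  shows "\<exists>X'. cfg (Copy second) hi X hx F hs G hc \<leadsto>
      cfg Rewind hi X' (int n - 1) F (hs + int (length xs)) G hc \<and>
    filled n X' \<and> (\<forall>i<hx. X' i = X i) \<and> holds X' hx (map letter (map (factor second) ps))"
  using assms
proof (induction xs arbitrary: ps hx hs X)
  case Nil
  have "cfg (Copy second) hi X hx F hs G hc \<leadsto> cfg Rewind hi X (int n - 1) F hs G hc"
    by (intro reach_step) (use Nil in \<open>simp_all add: filled_iff\<close>)
  with Nil show ?case by auto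
next
  case (Cons x xs)
  then obtain p ps' where ps [simp]: "ps = p # ps'" by (cases ps) auto
  let ?X = "X(hx := letter (factor second p))"
  have "filled n ?X"
    using Cons.prems by (intro filled_upd) auto
  then have "\<exists>X'. cfg (Copy second) hi ?X (hx + 1) F (hs + 1) G hc \<leadsto>
      cfg Rewind hi X' (int n - 1) F (hs + 1 + int (length xs)) G hc \<and>
      filled n X' \<and>
      (\<forall>i<hx + 1. X' i = ?X i) \<and>
      holds X' (hx + 1) (map letter (map (factor second) ps'))"
    by (rule Cons.IH) (use Cons.prems in auto)
  then obtain X' where X': "cfg (Copy second) hi ?X (hx + 1) F (hs + 1) G hc \<leadsto>
      cfg Rewind hi X' (int n - 1) F (hs + 1 + int (length xs)) G hc"
    "filled n X'" "\<forall>i<hx + 1. X' i = ?X i" "holds X' (hx + 1) (map letter (map (factor second) ps'))"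
    by blast
  have "cfg (Copy second) hi X hx F hs G hc \<leadsto>
      cfg Rewind hi X' (int n - 1) F (hs + 1 + int (length xs)) G hc"
    by (rule reach_step)
      (use X'(1) Cons.prems in \<open>simp_all add: filled_iff factor_def case_prod_beta\<close>)
  with X'(2-) show ?case
    by (intro exI[of _ X']) (auto simp: algebra_simps)
qed

lemma sweep_Next:
  assumes "filled n X" "in_range hi hs hc" "0 \<le> hs" "hs + int (length xs) \<le> int P"
    and "holds F hs (map cell (zip xs ps))" "length ps = length xs"
    and "0 \<le> hx" "hx + int (length xs) = int n"
  shows "\<exists>F'. cfg (Next k) hi X hx F hs G hc \<leadsto>
      (if fst (incr k ps)
       then cfg (Pop False) hi X (int n - 1) F' (hs + int (length xs) - 1) G (hc + 1)
       else cfg (Check True) hi X (int n - 1) F' (hs + int (length xs) - 1) G hc) \<and>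
    (\<forall>i<hs. F' i = F i) \<and> holds F' hs (map cell (zip xs (snd (incr k ps))))"
  using assms(2-)
proof (induction xs arbitrary: ps hx hs F k)
  case Nil
  have "cfg (Next k) hi X hx F hs G hc \<leadsto>
      (if k then cfg (Pop False) hi X (int n - 1) F (hs - 1) G (hc + 1)
       else cfg (Check True) hi X (int n - 1) F (hs - 1) G hc)"
    by (intro reach_step) (use Nil assms(1) in \<open>simp_all add: filled_iff\<close>)
  with Nil show ?case by auto
next
  case (Cons x xs)
  then obtain p ps' where ps [simp]: "ps = p # ps'" by (cases ps) auto
  \<comment> \<open>One digit of the odometer: \<open>p'\<close> replaces \<open>p\<close>, and
    \<open>k'\<close> is the carry into the next cell. This merges the cases of
    \<open>incr\<close>.\<close>
  define k' where "k' \<longleftrightarrow> k \<and> \<not> Suc (index p) < CARD('s \<times> 's)"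
  define p' where "p' = (if k then if Suc (index p) < CARD('s \<times> 's) then elem_at (Suc (index p)) else elem_at 0 else p)"
  have incr: "incr k ps = apsnd ((#) p') (incr k' ps')"
  proof -
    have "incr False qs = (False, qs)" for qs :: "('s \<times> 's) list" by (cases qs) auto
    then show ?thesis by (simp add: k'_def p'_def del: card_prod)
  qed
  let ?F = "F(hs := cell (x, p'))"
  have "holds ?F (hs + 1) (map cell (zip xs ps'))"
    using Cons.prems by (intro holds_upd) auto
  then have "\<exists>F'. cfg (Next k') hi X (hx + 1) ?F (hs + 1) G hc \<leadsto>
      (if fst (incr k' ps')
       then cfg (Pop False) hi X (int n - 1) F' (hs + 1 + int (length xs) - 1) G (hc + 1)
       else cfg (Check True) hi X (int n - 1) F' (hs + 1 + int (length xs) - 1) G hc) \<and>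
      (\<forall>i<hs + 1. F' i = ?F i) \<and>
      holds F' (hs + 1) (map cell (zip xs (snd (incr k' ps'))))"
    by (intro Cons.IH[of "hs + 1" ?F ps' "hx + 1" k'])
      (use Cons.prems in \<open>auto simp del: fun_upd_apply\<close>)
  then obtain F' where F': "cfg (Next k') hi X (hx + 1) ?F (hs + 1) G hc \<leadsto>
      (if fst (incr k' ps')
       then cfg (Pop False) hi X (int n - 1) F' (hs + 1 + int (length xs) - 1) G (hc + 1)
       else cfg (Check True) hi X (int n - 1) F' (hs + 1 + int (length xs) - 1) G hc)"
    "\<forall>i<hs + 1. F' i = ?F i" "holds F' (hs + 1) (map cell (zip xs (snd (incr k' ps'))))"
    by blast
  have "delta mul (Next k) (I hi) (X hx) (F hs) (G hc) =
      (Next k', Stay, (X hx, Right), (cell (x, p'), Right), (G hc, Stay))"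
    using Cons.prems assms(1) by (simp add: filled_iff k'_def p'_def del: card_prod)
  then have "cfg (Next k) hi X hx F hs G hc \<leadsto>
      (if fst (incr k' ps')
       then cfg (Pop False) hi X (int n - 1) F' (hs + 1 + int (length xs) - 1) G (hc + 1)
       else cfg (Check True) hi X (int n - 1) F' (hs + 1 + int (length xs) - 1) G hc)"
    by (intro reach_step) (use F'(1) Cons.prems in \<open>simp_all del: delta.simps\<close>)
  with F'(2,3) show ?case
    unfolding incr by (intro exI[of _ F']) (auto simp: algebra_simps)
qed

section \<open>Loading the target tuple and laying out the depth marks\<close>

lemma load_marks:
  assumes "I hi = letter s" "in_range hi hs hc" "hi < int N" "- 1 \<le> hx" "hx \<le> int n"
    and "j < CARD('s)" "filled m G" "hc = int m" "m + (CARD('s) - j) \<le> D"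
  shows "\<exists>G'. cfg (Load j) hi X hx F hs G hc \<leadsto>
      cfg (Load 0) (hi + 1) (X(hx := letter s)) (hx + 1) F hs G' (hc + int (CARD('s) - j)) \<and>
    filled (m + (CARD('s) - j)) G'"
  using assms(2,6-)
proof (induction "CARD('s) - j" arbitrary: j m G hc)
  case 0
  then show ?case by simp
next
  case (Suc k)
  let ?G = "G(hc := Aux 0)"
  have G: "filled (Suc m) ?G"
    using Suc.prems by (auto intro: filled_extend)
  show ?case
  proof (cases "Suc j < CARD('s)")
    case True
    have "\<exists>G'. cfg (Load (Suc j)) hi X hx F hs ?G (hc + 1) \<leadsto>
        cfg (Load 0) (hi + 1) (X(hx := letter s)) (hx + 1) F hs G' (hc + 1 + int (CARD('s) - Suc j)) \<and>
        filled (Suc m + (CARD('s) - Suc j)) G'"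
      by (rule Suc.hyps(1)) (use Suc.hyps(2) Suc.prems G True in auto)
    then obtain G' where G': "cfg (Load (Suc j)) hi X hx F hs ?G (hc + 1) \<leadsto>
        cfg (Load 0) (hi + 1) (X(hx := letter s)) (hx + 1) F hs G' (hc + 1 + int (CARD('s) - Suc j))"
      "filled (Suc m + (CARD('s) - Suc j)) G'"
      by blast
    have "cfg (Load j) hi X hx F hs G hc \<leadsto>
        cfg (Load 0) (hi + 1) (X(hx := letter s)) (hx + 1) F hs G' (hc + 1 + int (CARD('s) - Suc j))"
      by (rule reach_step) (use G'(1) True Suc.prems assms in simp_all)
    with G'(2) True show ?thesis
      by (intro exI[of _ G']) (simp add: Suc_diff_Suc of_nat_diff algebra_simps)
  next
    case False
    with Suc.prems have j: "CARD('s) - j = 1" by linarith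
    have "cfg (Load j) hi X hx F hs G hc \<leadsto>
        cfg (Load 0) (hi + 1) (X(hx := letter s)) (hx + 1) F hs ?G (hc + 1)"
      by (rule reach_step) (use False Suc.prems assms in simp_all)
    with G j show ?thesis by auto
  qed
qed

lemma load:
  assumes "holds I (int m) (map letter bs)" "m + length bs = n"
    and "filled m X" "holds X 0 (map letter cs)" "length cs = m" "filled (CARD('s) * m) G"
  shows "\<exists>X' G'. cfg (Load 0) (int m) X (int m) F 0 G (int (CARD('s) * m)) \<leadsto>
      cfg Rewind (int n - 1) X' (int n - 1) F 0 G' (int D - 1) \<and>
    filled n X' \<and> holds X' 0 (map letter (cs @ bs)) \<and> filled D G'"
  using assms
proof (induction bs arbitrary: m X cs G)
  case Nil
  have "n \<le> N" "- 1 \<le> int CARD('s) * int n"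
    by (simp_all add: N_def w_def n_def order_trans[of _ 0])
  \<comment> \<open>The first block ends here, with the input if there is no generator and with a
    separator otherwise.\<close>
  have "I (int n) = Blank \<or> I (int n) = Letter None"
  proof (cases as)
    case Nil
    then have "N = n" unfolding N_def w_def n_def by simp
    then show ?thesis using filled_iff[OF filled_I, of "int n"] by simp
  next
    case (Cons a as')
    then show ?thesis using holds_I unfolding w_def n_def by simp
  qed
  then have "cfg (Load 0) (int m) X (int m) F 0 G (int (CARD('s) * m)) \<leadsto>
      cfg Rewind (int n - 1) X (int n - 1) F 0 G (int D - 1)"
    using Nil \<open>n \<le> N\<close> \<open>- 1 \<le> int CARD('s) * int n\<close> by (intro reach_step) (auto simp: D_def filled_iff)
  with Nil show ?case by (auto simp: D_def)
next
  case (Cons s bs)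
  have le: "m < n" "n \<le> N"
    using Cons.prems by (auto simp: N_def w_def n_def)
  have mD: "CARD('s) * Suc m \<le> D"
    unfolding D_def using le by (intro mult_le_mono2) simp
  have "CARD('s) * m \<le> D"
    using mD by simp
  then have bounds: "- 1 \<le> int CARD('s) * int m" "int CARD('s) * int m \<le> int D"
    by (simp_all add: order_trans[of _ 0] flip: of_nat_mult)
  obtain G1 where G1: "cfg (Load 0) (int m) X (int m) F 0 G (int (CARD('s) * m)) \<leadsto>
      cfg (Load 0) (int m + 1) (X(int m := letter s)) (int m + 1) F 0 G1
        (int (CARD('s) * m) + int (CARD('s) - 0))"
    "filled (CARD('s) * m + (CARD('s) - 0)) G1"
    using load_marks[of "int m" s 0 "int (CARD('s) * m)" "int m" 0 "CARD('s) * m" G X F]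
      Cons.prems le mD bounds by auto
  have "filled (Suc m) (X(int m := letter s))" "holds (X(int m := letter s)) 0 (map letter (cs @ [s]))"
    using Cons.prems by (auto intro: filled_extend holds_upd)
  then have "\<exists>X' G'. cfg (Load 0) (int (Suc m)) (X(int m := letter s)) (int (Suc m)) F 0 G1
        (int (CARD('s) * Suc m)) \<leadsto> cfg Rewind (int n - 1) X' (int n - 1) F 0 G' (int D - 1) \<and>
      filled n X' \<and> holds X' 0 (map letter ((cs @ [s]) @ bs)) \<and> filled D G'"
    by (intro Cons.IH)
      (use Cons.prems G1(2) in \<open>simp_all add: algebra_simps del: fun_upd_apply\<close>)
  then obtain X' G' where *: "cfg (Load 0) (int (Suc m)) (X(int m := letter s)) (int (Suc m)) F 0 G1
        (int (CARD('s) * Suc m)) \<leadsto>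
      cfg Rewind (int n - 1) X' (int n - 1) F 0 G' (int D - 1)"
    "filled n X'" "holds X' 0 (map letter ((cs @ [s]) @ bs))" "filled D G'"
    by blast
  have "cfg (Load 0) (int m) X (int m) F 0 G (int (CARD('s) * m)) \<leadsto>
      cfg Rewind (int n - 1) X' (int n - 1) F 0 G' (int D - 1)"
    using G1(1) *(1) by (elim reach_trans) (simp add: algebra_simps)
  with *(2-) show ?case by auto
qed

section \<open>The search\<close>

text \<open>
  Here \<open>r\<close> is the number of levels that are left, and \<open>p\<close> the first free cell of the stack.
  The head of tape 3 stands at \<open>r - 1\<close> when a tuple is about to be tested, and at \<open>r\<close> on return.
\<close>

definition answers where
  "answers c r v F p G \<longleftrightarrow> (\<exists>hi X F' G'.
     c \<leadsto> cfg (Return v) hi X (int n) F' p G' (int r) \<and> - 1 \<le> hi \<and> hi < int N \<and>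
     filled n X \<and> filled D G' \<and> (\<forall>i<p. F' i = F i) \<and> (\<forall>i\<ge>int r. G' i = G i))"

lemma answersI:
  "\<lbrakk>c \<leadsto> cfg (Return v) hi X (int n) F' p G' (int r); - 1 \<le> hi; hi < int N; filled n X; filled D G';
    \<And>i. i < p \<Longrightarrow> F' i = F i; \<And>i. int r \<le> i \<Longrightarrow> G' i = G i\<rbrakk> \<Longrightarrow> answers c r v F p G"
  unfolding answers_def by blast

lemma answers_reach:
  assumes "answers c' r v F' p G'" "c \<leadsto> c'" "\<And>i. i < p \<Longrightarrow> F' i = F i" "\<And>i. int r \<le> i \<Longrightarrow> G' i = G i"
  shows "answers c r v F p G"
proof -
  from assms(1) obtain hi X F'' G'' where
    "c' \<leadsto> cfg (Return v) hi X (int n) F'' p G'' (int r)" "- 1 \<le> hi" "hi < int N" "filled n X"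
    "filled D G''" "\<forall>i<p. F'' i = F' i" "\<forall>i\<ge>int r. G'' i = G' i"
    unfolding answers_def by blast
  with assms(2-4) show ?thesis
    by (intro answersI[of c v hi X F'' p G'']) (auto intro: reach_trans)
qed

section \<open>The recursive test and the loop over factorizations\<close>

definition tree where
  "tree = split_tree (map2 mul) (power_carrier n) (set as)"

text \<open>Contract of the recursive test with \<open>r\<close> levels left and the stack free from
  \<open>p\<close> on. It covers all head positions and contents that a caller may leave behind,
  while \<open>answers\<close> protects the data of the callers: the cells below \<open>p\<close>
  and the marks from \<open>r\<close> on.\<close>

definition evaluates where
  "evaluates r p \<longleftrightarrow> (\<forall>xs hi X hx F G.
     length xs = n \<longrightarrow> filled n X \<longrightarrow> holds X 0 (map letter xs) \<longrightarrow> - 1 \<le> hi \<longrightarrow> hi < int N \<longrightarrow>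
     - 1 \<le> hx \<longrightarrow> hx < int n \<longrightarrow> filled D G \<longrightarrow>
     answers (cfg Rewind hi X hx F p G (int r - 1)) r (tree r xs) F p G)"

definition factors where
  "factors r xs ps \<longleftrightarrow> map2 mul (map fst ps) (map snd ps) = xs \<and>
     tree r (map fst ps) \<and> tree r (map snd ps)"

text \<open>The loop is cut open here: \<open>IH\<close> is the loop continued with the next
  candidate, supplied later by induction. On overflow no candidate has a larger number, so the
  answer is negative.\<close>

lemma Next_answers:
  assumes p: "0 \<le> p" "p + int n \<le> int P" and r: "r < D"
    and len: "length xs = n" "length ps = n" and frame: "holds F p (map cell (zip xs ps))"
    and X: "filled n X" and hi: "- 1 \<le> hi" "hi < int N" and G: "filled D G"
    and IH: "\<And>ps' F'. \<lbrakk>num ps' = Suc (num ps); length ps' = n; holds F' p (map cell (zip xs ps'))\<rbrakk> \<Longrightarrow>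
      answers (cfg (Check True) hi X (int n - 1) F' (p + int n - 1) G (int r - 1)) (Suc r)
        (\<exists>qs. length qs = n \<and> num ps' \<le> num qs \<and> factors r xs qs) F' p G"
  shows "answers (cfg (Next True) hi X 0 F p G (int r - 1)) (Suc r)
    (\<exists>qs. length qs = n \<and> num ps < num qs \<and> factors r xs qs) F p G"
proof -
  obtain F' where F': "cfg (Next True) hi X 0 F p G (int r - 1) \<leadsto>
      (if fst (incr True ps)
       then cfg (Pop False) hi X (int n - 1) F' (p + int n - 1) G (int r)
       else cfg (Check True) hi X (int n - 1) F' (p + int n - 1) G (int r - 1))"
    "\<forall>i<p. F' i = F i" "holds F' p (map cell (zip xs (snd (incr True ps))))"
    using sweep_Next[of X hi p "int r - 1" xs F ps 0 True G, unfolded len(1) diff_add_cancel] assms(1-10)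
    by auto
  show ?thesis
  proof (cases "fst (incr True ps)")
    case True
    have none: "(\<exists>qs. length qs = n \<and> num ps < num qs \<and> factors r xs qs) = False"
      using incr_overflow[OF True] num_less[where 'a = "'s \<times> 's"] len by (metis Suc_leI not_less)
    have "cfg (Pop False) hi X (int n - 1) F' (p + int n - 1) G (int r) \<leadsto>
        cfg (To_End False) hi X 0 F' p G (int r)"
      by (rule sweep_left) (use assms in auto)
    moreover have "cfg (To_End False) hi X 0 F' p G (int r) \<leadsto>
        cfg (Return False) hi X (int n) F' p G (int r + 1)"
      by (rule to_end) (use assms in auto)
    ultimately have "cfg (Next True) hi X 0 F p G (int r - 1) \<leadsto>
        cfg (Return False) hi X (int n) F' p G (int (Suc r))"
      using F'(1) True by (auto simp: algebra_simps elim!: reach_trans)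
    then show ?thesis
      unfolding none using F'(2) assms by (intro answersI[where F' = F' and G' = G]) auto
  next
    case False
    let ?ps = "snd (incr True ps)"
    have "num ?ps = Suc (num ps)"
      using num_incr[OF False] .
    moreover from this have "answers (cfg (Check True) hi X (int n - 1) F' (p + int n - 1) G (int r - 1)) (Suc r)
        (\<exists>qs. length qs = n \<and> num ?ps \<le> num qs \<and> factors r xs qs) F' p G"
      using F'(3) len by (intro IH) auto
    ultimately show ?thesis
      using F' False by (auto simp: Suc_le_eq intro: answers_reach)
  qed
qed

lemma Return_False:
  assumes "0 \<le> p" "p + int n \<le> int P" "r < D" "length xs = n" "length ps = n"
    and "holds F p (map cell (zip xs ps))" "filled n X" "- 1 \<le> hi" "hi < int N" "filled D G"
  shows "cfg (Return False) hi X (int n) F (p + int n) G (int r) \<leadsto>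
    cfg (Next True) hi X 0 F p (G(int r := Aux 0)) (int r - 1)"
proof -
  have "cfg (Check False) hi X (int n - 1) F (p + int n - 1) (G(int r := Aux 0)) (int r - 1) \<leadsto>
      cfg (Next True) hi X 0 F p (G(int r := Aux 0)) (int r - 1)"
    using sweep_Check[of X hi p "int r - 1" "zip xs ps" F False] assms by simp
  then show ?thesis
    by (intro reach_step) (use assms in \<open>simp_all add: filled_iff\<close>)
qed

text \<open>Induction on the number of candidates from the current one on. The mark
  \<open>Aux 0\<close> at \<open>r\<close> belongs to the invariant: it says that the next return
  concerns the first factor.\<close>

lemma Check_answers:
  assumes p: "0 \<le> p" "p + int n \<le> int P" and r: "r < D" and child: "evaluates r (p + int n)"
    and xs: "length xs = n" and "length ps = n" "holds F p (map cell (zip xs ps))"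
    and "filled n X" "- 1 \<le> hi" "hi < int N" "filled D G" "G (int r) = Aux 0"
  shows "answers (cfg (Check True) hi X (int n - 1) F (p + int n - 1) G (int r - 1)) (Suc r)
    (\<exists>qs. length qs = n \<and> num ps \<le> num qs \<and> factors r xs qs) F p G"
  using assms(6-)
proof (induction "CARD('s \<times> 's) ^ n - num ps" arbitrary: ps F X hi G rule: less_induct)
  case less
  let ?R = "\<exists>qs. length qs = n \<and> num ps \<le> num qs \<and> factors r xs qs"
  have next_answers: "answers (cfg (Next True) hi' X' 0 F' p G' (int r - 1)) (Suc r) ?R F p G"
    if "\<not> factors r xs ps" "holds F' p (map cell (zip xs ps))" "filled n X'" "- 1 \<le> hi'" "hi' < int N"
      "filled D G'" "G' (int r) = Aux 0" "\<And>i. i < p \<Longrightarrow> F' i = F i"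
      "\<And>i. int (Suc r) \<le> i \<Longrightarrow> G' i = G i"
    for hi' X' F' G'
  proof -
    have "?R \<longleftrightarrow> (\<exists>qs. length qs = n \<and> num ps < num qs \<and> factors r xs qs)"
      using that(1) less.prems(1) num_inj[of ps] by (metis le_neq_implies_less less_imp_le)
    moreover have "answers (cfg (Next True) hi' X' 0 F' p G' (int r - 1)) (Suc r)
        (\<exists>qs. length qs = n \<and> num ps < num qs \<and> factors r xs qs) F' p G'"
    proof (rule Next_answers)
      fix ps' F''
      assume ps': "num ps' = Suc (num ps)" "length ps' = n" "holds F'' p (map cell (zip xs ps'))"
      have "CARD('s \<times> 's) ^ n - num ps' < CARD('s \<times> 's) ^ n - num ps"
        using ps' num_less[of ps'] by simp
      then show "answers (cfg (Check True) hi' X' (int n - 1) F'' (p + int n - 1) G' (int r - 1)) (Suc r)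
          (\<exists>qs. length qs = n \<and> num ps' \<le> num qs \<and> factors r xs qs) F'' p G'"
        using ps' that by (intro less.hyps) auto
    qed (use p r xs less.prems that in auto)
    ultimately show ?thesis
      using that(8,9) by (auto intro: answers_reach)
  qed
  have return_False: "answers (cfg (Return False) hi' X' (int n) F' (p + int n) G' (int r)) (Suc r) ?R F p G"
    if "\<not> factors r xs ps" "holds F' p (map cell (zip xs ps))" "filled n X'" "- 1 \<le> hi'" "hi' < int N"
      "filled D G'" "\<And>i. i < p \<Longrightarrow> F' i = F i" "\<And>i. int (Suc r) \<le> i \<Longrightarrow> G' i = G i"
    for hi' X' F' G'
  proof (rule answers_reach)
    show "answers (cfg (Next True) hi' X' 0 F' p (G'(int r := Aux 0)) (int r - 1)) (Suc r) ?R F p G"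
      using r that by (intro next_answers filled_upd) auto
    show "cfg (Return False) hi' X' (int n) F' (p + int n) G' (int r) \<leadsto>
        cfg (Next True) hi' X' 0 F' p (G'(int r := Aux 0)) (int r - 1)"
      using p r xs less.prems(1) that by (intro Return_False) auto
  qed auto
  have check: "cfg (Check True) hi X (int n - 1) F (p + int n - 1) G (int r - 1) \<leadsto>
      cfg (if map2 mul (map fst ps) (map snd ps) = xs then Copy False else Next True)
        hi X 0 F p G (int r - 1)"
    using sweep_Check[of X hi p "int r - 1" "zip xs ps" F True] p r xs less.prems
    by (simp add: map2_eq_iff_zip)
  \<comment> \<open>The call on one factor. The child works above this frame and leaves the cells
    below \<open>p + int n\<close> alone, so the frame survives.\<close>
  have child_answers: "\<exists>hi2 X2 F2 G2. cfg (Copy second) hi' X' 0 F' p G' (int r - 1) \<leadsto>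
      cfg (Return (tree r (map (factor second) ps))) hi2 X2 (int n) F2 (p + int n) G2 (int r) \<and>
      - 1 \<le> hi2 \<and> hi2 < int N \<and> filled n X2 \<and> filled D G2 \<and>
      holds F2 p (map cell (zip xs ps)) \<and> (\<forall>i<p. F2 i = F' i) \<and> (\<forall>i\<ge>int r. G2 i = G' i)"
    if asm: "holds F' p (map cell (zip xs ps))" "filled n X'" "- 1 \<le> hi'" "hi' < int N" "filled D G'"
    for second hi' X' F' G'
  proof -
    obtain X1 where X1: "cfg (Copy second) hi' X' 0 F' p G' (int r - 1) \<leadsto>
        cfg Rewind hi' X1 (int n - 1) F' (p + int n) G' (int r - 1)"
      "filled n X1" "holds X1 0 (map letter (map (factor second) ps))"
      using sweep_Copy[of X' hi' p "int r - 1" xs F' ps 0 second G'] p r xs less.prems asm by auto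
    have "answers (cfg Rewind hi' X1 (int n - 1) F' (p + int n) G' (int r - 1)) r
        (tree r (map (factor second) ps)) F' (p + int n) G'"
      using child X1 asm less.prems(1) unfolding evaluates_def by (elim allE impE) auto
    then obtain hi2 X2 F2 G2 where *: "cfg Rewind hi' X1 (int n - 1) F' (p + int n) G' (int r - 1) \<leadsto>
        cfg (Return (tree r (map (factor second) ps))) hi2 X2 (int n) F2 (p + int n) G2 (int r)"
      "- 1 \<le> hi2" "hi2 < int N" "filled n X2" "filled D G2" "\<forall>i<p + int n. F2 i = F' i"
      "\<forall>i\<ge>int r. G2 i = G' i"
      unfolding answers_def by blast
    have "holds F2 p (map cell (zip xs ps))"
      using asm(1) by (rule holds_cong) (use * xs less.prems(1) in auto)
    moreover have "\<forall>i<p. F2 i = F' i"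
      using *(6) by auto
    ultimately show ?thesis
      using reach_trans[OF X1(1) *(1)] *(2-) by blast
  qed
  show ?case
  proof (cases "map2 mul (map fst ps) (map snd ps) = xs")
    case False
    then have "answers (cfg (Next True) hi X 0 F p G (int r - 1)) (Suc r) ?R F p G"
      using less.prems by (intro next_answers) (auto simp: factors_def)
    with check False show ?thesis by (auto intro: answers_reach)
  next
    case prod: True
    obtain hi2 X2 F2 G2 where fst: "cfg (Copy False) hi X 0 F p G (int r - 1) \<leadsto>
        cfg (Return (tree r (map (factor False) ps))) hi2 X2 (int n) F2 (p + int n) G2 (int r)"
      "- 1 \<le> hi2" "hi2 < int N" "filled n X2" "filled D G2"
      "holds F2 p (map cell (zip xs ps))" "\<forall>i<p. F2 i = F i" "\<forall>i\<ge>int r. G2 i = G i"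
      using child_answers[of F X hi G False] less.prems by blast
    have factor: "map (factor False) ps = map fst ps" "map (factor True) ps = map snd ps"
      by (simp_all add: factor_def)
    show ?thesis
    proof (cases "tree r (map fst ps)")
      case False
      then have "answers (cfg (Return False) hi2 X2 (int n) F2 (p + int n) G2 (int r)) (Suc r) ?R F p G"
        using fst by (intro return_False) (auto simp: factors_def)
      moreover have "cfg (Check True) hi X (int n - 1) F (p + int n - 1) G (int r - 1) \<leadsto>
          cfg (Return False) hi2 X2 (int n) F2 (p + int n) G2 (int r)"
        using check fst(1) prod False unfolding factor by (auto elim: reach_trans)
      ultimately show ?thesis by (rule answers_reach) auto
    next
      case left: True
      \<comment> \<open>The child keeps all marks from \<open>r\<close> on, so the first return
        finds \<open>Aux 0\<close> and the second one the \<open>Aux 1\<close> written here; this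
        tells them apart.\<close>
      let ?G = "G2(int r := Aux 1)"
      have G: "filled D ?G"
        using fst r by (intro filled_upd) auto
      have "cfg Second hi2 X2 (int n - 1) F2 (p + int n - 1) ?G (int r - 1) \<leadsto>
          cfg (Copy True) hi2 X2 0 F2 p ?G (int r - 1)"
        by (rule sweep_left) (use fst p r in auto)
      then have second: "cfg (Return True) hi2 X2 (int n) F2 (p + int n) G2 (int r) \<leadsto>
          cfg (Copy True) hi2 X2 0 F2 p ?G (int r - 1)"
        by (intro reach_step) (use fst p r less.prems in simp_all)
      obtain hi3 X3 F3 G3 where snd: "cfg (Copy True) hi2 X2 0 F2 p ?G (int r - 1) \<leadsto>
          cfg (Return (tree r (map (factor True) ps))) hi3 X3 (int n) F3 (p + int n) G3 (int r)"
        "- 1 \<le> hi3" "hi3 < int N" "filled n X3" "filled D G3"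
        "holds F3 p (map cell (zip xs ps))" "\<forall>i<p. F3 i = F2 i" "\<forall>i\<ge>int r. G3 i = ?G i"
        using child_answers[of F2 X2 hi2 ?G True] fst G by blast
      have F3: "F3 i = F i" if "i < p" for i
        using fst(7) snd(7) that by simp
      have G3: "G3 i = G i" if "int (Suc r) \<le> i" for i
        using fst(8) snd(8) that by simp
      have "answers (cfg (Return (tree r (map snd ps))) hi3 X3 (int n) F3 (p + int n) G3 (int r)) (Suc r) ?R F p G"
      proof (cases "tree r (map snd ps)")
        case False
        then show ?thesis
          using snd F3 G3 return_False[of F3 X3 hi3 G3] by (simp add: factors_def)
      next
        case True
        with prod left have "factors r xs ps" by (simp add: factors_def)
        with less.prems(1) have R: "?R" by blast
        have "cfg (Pop True) hi3 X3 (int n - 1) F3 (p + int n - 1) G3 (int r) \<leadsto>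
            cfg (To_End True) hi3 X3 0 F3 p G3 (int r)"
          by (rule sweep_left) (use snd p r in auto)
        moreover have "cfg (To_End True) hi3 X3 0 F3 p G3 (int r) \<leadsto>
            cfg (Return True) hi3 X3 (int n) F3 p G3 (int r + 1)"
          by (rule to_end) (use snd p r in auto)
        ultimately have "cfg (Pop True) hi3 X3 (int n - 1) F3 (p + int n - 1) G3 (int r) \<leadsto>
            cfg (Return True) hi3 X3 (int n) F3 p G3 (int (Suc r))"
          by (auto simp: algebra_simps elim: reach_trans)
        then have "cfg (Return True) hi3 X3 (int n) F3 (p + int n) G3 (int r) \<leadsto>
            cfg (Return True) hi3 X3 (int n) F3 p G3 (int (Suc r))"
          by (intro reach_step) (use snd p r in simp_all)
        then show ?thesis
          using R True snd F3 G3 by (auto intro!: answersI)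
      qed
      moreover have "cfg (Check True) hi X (int n - 1) F (p + int n - 1) G (int r - 1) \<leadsto>
          cfg (Return (tree r (map snd ps))) hi3 X3 (int n) F3 (p + int n) G3 (int r)"
        using check fst(1) second snd(1) prod left unfolding factor by (auto elim!: reach_trans)
      ultimately show ?thesis by (rule answers_reach) auto
    qed
  qed
qed

text \<open>Passes from two factor tuples to one tuple of pairs, the form in which a frame stores
  them and the odometer counts them.\<close>

lemma tree_Suc:
  "tree (Suc r) xs \<longleftrightarrow> xs \<in> set as \<or> (\<exists>qs. length qs = n \<and> factors r xs qs)"
proof -
  have "(\<exists>y z. length y = n \<and> length z = n \<and> map2 mul y z = xs \<and> tree r y \<and> tree r z) \<longleftrightarrow>
      (\<exists>qs. length qs = n \<and> factors r xs qs)"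
    (is "?L \<longleftrightarrow> ?R")
  proof
    assume ?L
    then obtain y z where "length y = n" "length z = n" "map2 mul y z = xs" "tree r y" "tree r z"
      by blast
    then show ?R
      by (intro exI[of _ "zip y z"]) (auto simp: factors_def)
  next
    assume ?R
    then obtain qs where "length qs = n" "factors r xs qs" by blast
    then show ?L
      by (intro exI[of _ "map fst qs"] exI[of _ "map snd qs"]) (auto simp: factors_def)
  qed
  then show ?thesis
    by (auto simp: tree_def power_carrier_def)
qed

text \<open>Each push lowers \<open>r\<close> by one and raises \<open>p\<close> by
  \<open>n\<close>, which preserves \<open>p + int (r * n) = int P\<close>; hence the stack never
  outgrows \<open>P\<close>.\<close>

lemma evaluate:
  assumes "\<forall>c \<in> set as. length c = n" "0 \<le> p" "p + int (r * n) = int P" "r \<le> D"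
  shows "evaluates r p"
proof -
  have *: "cfg Rewind hi X hx F p G hc \<leadsto> cfg (Scan_Back (xs \<in> set as)) (int N) X (- 1) F p G hc"
    if "length xs = n" "filled n X" "holds X 0 (map letter xs)" "- 1 \<le> hi" "hi < int N" "- 1 \<le> hx"
      "hx < int n" "0 \<le> p" "p \<le> int P" "- 1 \<le> hc" "hc \<le> int D" for xs hi X hx F p G hc
  proof -
    have "if \<forall>c \<in> set (b # as). length c = n
      then cfg (Scan False False) 0 X 0 F p G hc \<leadsto>
        cfg (Scan_Back (False \<or> False \<and> b = xs \<or> xs \<in> set as)) (int N) X (- 1) F p G hc
      else rejects (cfg (Scan False False) 0 X 0 F p G hc)"
      by (rule scan_blocks[where m = n]) (use that holds_I in \<open>auto simp: N_def w_def\<close>)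
    with assms(1) rewind[of X hi hx p hc F G] that show ?thesis
      by (auto simp: n_def elim: reach_trans)
  qed
  \<comment> \<open>Nothing is pushed if a generator was matched or no level is left. In the latter
    case the head of tape 3 is on the blank at -1, and \<open>f\<close> is the answer either
    way.\<close>
  have found: "answers (cfg (Scan_Back f) (int N) X (- 1) F p G (int r - 1)) r f F p G"
    if "filled n X" "0 \<le> p" "p \<le> int P" "r \<le> D" "filled D G" "f \<or> r = 0" for X F p G r f
  proof -
    have "cfg (To_End f) (int N - 1) X 0 F p G (int r - 1) \<leadsto>
        cfg (Return f) (int N - 1) X (int n) F p G (int r - 1 + 1)"
      by (rule to_end) (use that in auto)
    then have "cfg (Scan_Back f) (int N) X (- 1) F p G (int r - 1) \<leadsto>
        cfg (Return f) (int N - 1) X (int n) F p G (int r)"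
      by (intro reach_step)
        (use that filled_iff[OF filled_I] in \<open>auto simp: filled_iff\<close>)
    with that show ?thesis by (auto intro!: answersI)
  qed
  show ?thesis
    using assms(2-)
  proof (induction r arbitrary: p)
    case 0
    show ?case
      unfolding evaluates_def
    proof (intro allI impI)
      fix xs :: "'s list" and hi hx :: int and X F G :: "int \<Rightarrow> 's option symbol"
      assume a: "length xs = n" "filled n X" "holds X 0 (map letter xs)" "- 1 \<le> hi" "hi < int N"
        "- 1 \<le> hx" "hx < int n" "filled D G"
      show "answers (cfg Rewind hi X hx F p G (int 0 - 1)) 0 (tree 0 xs) F p G"
        using found[of X p 0 G "xs \<in> set as" F] *[of xs X hi hx p "- 1" F G] a 0
        by (auto simp: tree_def intro: answers_reach)
    qed
  next
    case (Suc r)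
    have "p + int n + int (r * n) = int P"
      using Suc.prems by (simp add: algebra_simps)
    then have p: "p + int n \<le> int P"
      using of_nat_0_le_iff[of "r * n"] by linarith
    have child: "evaluates r (p + int n)"
      using Suc.prems by (intro Suc.IH) (auto simp: algebra_simps)
    show ?case
      unfolding evaluates_def
    proof (intro allI impI)
      fix xs :: "'s list" and hi hx :: int and X F G :: "int \<Rightarrow> 's option symbol"
      assume a: "length xs = n" "filled n X" "holds X 0 (map letter xs)" "- 1 \<le> hi" "hi < int N"
        "- 1 \<le> hx" "hx < int n" "filled D G"
      have scan: "cfg Rewind hi X hx F p G (int (Suc r) - 1) \<leadsto>
          cfg (Scan_Back (xs \<in> set as)) (int N) X (- 1) F p G (int (Suc r) - 1)"
        by (rule *) (use a Suc.prems p in auto)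
      have "answers (cfg (Scan_Back (xs \<in> set as)) (int N) X (- 1) F p G (int (Suc r) - 1)) (Suc r)
          (tree (Suc r) xs) F p G"
      proof (cases "xs \<in> set as")
        case True
        then show ?thesis
          using found[of X p "Suc r" G True F] a Suc.prems p by (auto simp: tree_Suc)
      next
        case False
        \<comment> \<open>The first candidate has number 0, so the loop that begins there ranges
          over all factorizations.\<close>
        let ?G = "G(int r := Aux 0)" and ?ps = "replicate n (elem_at 0) :: ('s \<times> 's) list"
        obtain F' where F': "cfg Push (int N - 1) X 0 F p ?G (int r - 1) \<leadsto>
            cfg (Check True) (int N - 1) X (int n - 1) F' (p + int n - 1) ?G (int r - 1)"
          "\<forall>i<p. F' i = F i" "holds F' p (map (\<lambda>x. cell (x, elem_at 0)) xs)"
          using sweep_Push[of X "int N - 1" p "int r - 1" xs 0 F ?G] a Suc.prems p by auto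
        have "cfg (Scan_Back False) (int N) X (- 1) F p G (int (Suc r) - 1) \<leadsto>
            cfg (Check True) (int N - 1) X (int n - 1) F' (p + int n - 1) ?G (int r - 1)"
          by (intro reach_step)
            (use F'(1) a Suc.prems p filled_iff[OF filled_I, of "int N"] in \<open>simp_all add: filled_iff\<close>)
        moreover have "map (\<lambda>x. cell (x, elem_at 0)) xs = map cell (zip xs ?ps)"
          using a(1) by (simp add: zip_replicate2 comp_def)
        then have "answers (cfg (Check True) (int N - 1) X (int n - 1) F' (p + int n - 1) ?G (int r - 1)) (Suc r)
            (\<exists>qs. length qs = n \<and> num ?ps \<le> num qs \<and> factors r xs qs) F' p ?G"
          using F'(3) a Suc.prems p child by (intro Check_answers filled_upd) auto
        ultimately show ?thesis
          using F'(2) False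
          by (auto simp: tree_Suc num_replicate intro: answers_reach)
      qed
      then show "answers (cfg Rewind hi X hx F p G (int (Suc r) - 1)) (Suc r) (tree (Suc r) xs) F p G"
        using scan by (rule answers_reach) auto
    qed
  qed
qed

section \<open>From the initial configuration to the verdict and the space bound\<close>

lemma start: "\<exists>X G. init (machine mul) w \<leadsto>
    cfg Rewind (int n - 1) X (int n - 1) (\<lambda>_. Blank) 0 G (int D - 1) \<and>
    filled n X \<and> holds X 0 (map letter b) \<and> filled D G"
proof -
  have "init (machine mul) w =
      cfg (Load 0) 0 (\<lambda>_. Blank) 0 (\<lambda>_. Blank) 0 (\<lambda>_. Blank) 0"
    by (simp add: init_def machine_def cfg_def blank_tape_def I_def numeral_eq_Suc input_tape_def)
  moreover have "holds I 0 (map letter b)"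
    using holds_I by (simp add: w_def letter_def[abs_def] comp_def)
  ultimately show ?thesis
    using load[of 0 b "\<lambda>_. Blank" "[]" "\<lambda>_. Blank" "\<lambda>_. Blank"] by (simp add: n_def filled_def)
qed

lemma halts:
  assumes "semigroup mul"
  shows "\<exists>c. init (machine mul) w \<leadsto> c \<and> ok c \<and>
    fst c = (if w \<in> SMP_language mul then Accept else Reject)"
proof -
  have n: "n \<le> N"
    by (simp add: N_def w_def n_def)
  obtain X G where X: "init (machine mul) w \<leadsto>
      cfg Rewind (int n - 1) X (int n - 1) (\<lambda>_. Blank) 0 G (int D - 1)"
    "filled n X" "holds X 0 (map letter b)" "filled D G"
    using start by blast
  \<comment> \<open>The word determines \<open>as\<close> and \<open>b\<close>, so it has only this
    reading as an instance.\<close>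
  have lang: "w \<in> SMP_language mul \<longleftrightarrow>
      (\<forall>c \<in> set as. length c = n) \<and> b \<in> generated (map2 mul) (set as)"
  proof -
    have "w \<in> SMP_language mul \<longleftrightarrow> (\<exists>m. (m, as, b) \<in> SMP mul)"
      unfolding SMP_language_def w_def
      by (auto simp: encode_eq_iff simp del: encode.simps)
        (metis encode_eq_iff image_eqI)
    then show ?thesis
      by (auto simp: SMP_def SMP_instances_def power_carrier_def n_def)
  qed
  show ?thesis
  proof (cases "\<forall>c \<in> set as. length c = n")
    case True
    let ?V = "power_carrier n :: 's list set"
    have "card ?V \<le> 2 ^ D"
    proof -
      have "card ?V = CARD('s) ^ n"
        using card_lists_length_eq[of "UNIV :: 's set" n] by (simp add: power_carrier_def)
      also have "\<dots> \<le> (2 ^ CARD('s)) ^ n"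
        by (intro power_mono less_imp_le less_exp) simp
      finally show ?thesis by (simp add: D_def power_mult)
    qed
    moreover have "finite ?V"
      using finite_lists_length_eq[of "UNIV :: 's set" n] by (simp add: power_carrier_def)
    ultimately have "tree D b \<longleftrightarrow> b \<in> generated (map2 mul) (set as)"
      unfolding tree_def using True map2_assoc[OF assms]
      by (intro split_tree_iff_generated) (auto simp: power_carrier_def)
    with lang True have v: "tree D b \<longleftrightarrow> w \<in> SMP_language mul" by simp
    have "evaluates D 0"
      using True by (intro evaluate) (auto simp: P_def)
    then have "answers (cfg Rewind (int n - 1) X (int n - 1) (\<lambda>_. Blank) 0 G (int D - 1)) D (tree D b)
        (\<lambda>_. Blank) 0 G"
      unfolding evaluates_def by (elim allE impE) (use X n in \<open>auto simp: n_def\<close>)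
    then obtain hi X' F' G' where *: "cfg Rewind (int n - 1) X (int n - 1) (\<lambda>_. Blank) 0 G (int D - 1) \<leadsto>
        cfg (Return (tree D b)) hi X' (int n) F' 0 G' (int D)"
      "- 1 \<le> hi" "hi < int N" "filled D G'"
      unfolding answers_def by blast
    let ?c = "cfg (if tree D b then Accept else Reject) hi X' (int n) F' 0 G' (int D)"
    have "cfg (Return (tree D b)) hi X' (int n) F' 0 G' (int D) \<leadsto> ?c"
      by (intro reach_step) (use * in \<open>simp_all add: filled_iff\<close>)
    then have "init (machine mul) w \<leadsto> ?c" "ok ?c" "fst ?c = (if tree D b then Accept else Reject)"
      using X(1) *(1-3) by (auto elim: reach_trans)
    with v show ?thesis by metis
  next
    case False
    \<comment> \<open>The very first scan, with \<open>b\<close> itself on tape 1, runs through all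
      blocks and meets the one of wrong length before anything is pushed.\<close>
    have "if \<forall>c \<in> set (b # as). length c = n
      then cfg (Scan False False) 0 X 0 (\<lambda>_. Blank) 0 G (int D - 1) \<leadsto>
        cfg (Scan_Back (False \<or> False \<and> b = b \<or> b \<in> set as)) (int N) X (- 1) (\<lambda>_. Blank) 0 G (int D - 1)
      else rejects (cfg (Scan False False) 0 X 0 (\<lambda>_. Blank) 0 G (int D - 1))"
      by (rule scan_blocks[where m = n]) (use X holds_I in \<open>auto simp: N_def w_def n_def\<close>)
    with False have "rejects (cfg (Scan False False) 0 X 0 (\<lambda>_. Blank) 0 G (int D - 1))"
      by auto
    moreover have "cfg Rewind (int n - 1) X (int n - 1) (\<lambda>_. Blank) 0 G (int D - 1) \<leadsto>
        cfg (Scan False False) 0 X 0 (\<lambda>_. Blank) 0 G (int D - 1)"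
      by (rule rewind) (use X n in auto)
    ultimately have "rejects (init (machine mul) w)"
      using X(1) by (blast intro: rejects_reach)
    with lang False show ?thesis unfolding rejects_def by auto
  qed
qed

text \<open>Each of the four heads stays between -1 and the sum M of all bounds, an interval of M +
  2 cells.\<close>

lemma scanned_cells_le:
  assumes "\<And>s. ok (run (machine mul) w s)"
  shows "scanned_cells (machine mul) w t \<le> 4 * (N + n + P + D + 2)"
proof -
  have in_range: "(i, snd (snd (run (machine mul) w s) ! i)) \<in> {..<4} \<times> {- 1..int (N + n + P + D)}"
    if "i < tm_tapes (machine mul)" for i s
  proof -
    from that have "i < 4" by (simp add: machine_def)
    moreover have "length (snd (run (machine mul) w s)) = 4"
      using assms[of s] by (auto simp: ok_def dest: list_all2_lengthD)
    ultimately have "- 1 \<le> snd (snd (run (machine mul) w s) ! i) \<and>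
        snd (snd (run (machine mul) w s) ! i) \<le> int ([N, n, P, D] ! i)"
      using assms[of s] by (auto simp: ok_def list_all2_conv_all_nth)
    moreover have "[N, n, P, D] ! i \<le> N + n + P + D"
      using \<open>i < 4\<close> by (auto simp: numeral_eq_Suc less_Suc_eq)
    ultimately show ?thesis
      using \<open>i < 4\<close> by auto
  qed
  have "{(i, snd (snd (run (machine mul) w s) ! i)) | i s. i < tm_tapes (machine mul) \<and> s \<le> t} \<subseteq>
      {..<4} \<times> {- 1..int (N + n + P + D)}"
    using in_range by blast
  then have "scanned_cells (machine mul) w t \<le> card ({..<4::nat} \<times> {- 1..int (N + n + P + D)})"
    unfolding scanned_cells_def by (intro card_mono) auto
  also have "\<dots> = 4 * (N + n + P + D + 2)"
    by (simp add: card_cartesian_product nat_add_distrib)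
  finally show ?thesis .
qed

text \<open>With n \<le> N and c = \<open>CARD('s)\<close> the left side is at most 4 * (2 * N + c *
  N * N + c * N + 2), whence the coefficients; the quadratic term is the stack.\<close>

lemma space_bound: "4 * (N + n + P + D + 2) \<le> poly [:8, 8 + 4 * CARD('s), 4 * CARD('s):] (length w)"
proof -
  have n: "n \<le> N"
    by (simp add: N_def w_def n_def)
  then have "D \<le> CARD('s) * N" unfolding D_def by (intro mult_le_mono) auto
  moreover from this n have "P \<le> CARD('s) * N * N" unfolding P_def by (intro mult_le_mono)
  ultimately show ?thesis
    using n unfolding N_def by (simp add: algebra_simps)
qed

end

text \<open>Brings every word, well-formed or not, under the preceding analysis: a leading letter
  extends the first block, and a leading separator opens a new empty one.\<close>

lemma encode_surj: "\<exists>as b. w = encode (m, as, b)"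
proof (induction w)
  case Nil
  show ?case by (intro exI[of _ "[]"]) simp
next
  case (Cons s w)
  then obtain as b where w: "w = encode (m, as, b)" by blast
  show ?case
  proof (cases s)
    case None
    with w show ?thesis by (intro exI[of _ "b # as"] exI[of _ "[]"]) simp
  next
    case (Some x)
    with w show ?thesis by (intro exI[of _ as] exI[of _ "x # b"]) simp
  qed
qed

theorem theorem2p1:
  fixes mul :: "'s::finite \<Rightarrow> 's \<Rightarrow> 's"
  assumes "semigroup mul"
  shows "SMP_language mul \<in> PSPACE"
proof (rule PSPACE_I)
  show "tm_wf (machine mul)"
    by (rule tm_wf_machine)
  have halt: "(\<exists>t. fst (run (machine mul) w t) =
        (if w \<in> SMP_language mul then tm_accept (machine mul) else tm_reject (machine mul))) \<and>
      scanned_cells (machine mul) w t \<le> poly [:8, 8 + 4 * CARD('s), 4 * CARD('s):] (length w)"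
    for w t
  proof -
    obtain as b where "w = encode (0, as, b)"
      using encode_surj by blast
    then have w: "w = smp_run.w as b"
      by (simp add: smp_run.w_def)
    obtain c where c: "(bounded_step (machine mul) (smp_run.ok as b))\<^sup>*\<^sup>* (init (machine mul) w) c"
      "smp_run.ok as b c" "fst c = (if w \<in> SMP_language mul then Accept else Reject)"
      using smp_run.halts[OF assms, of as b] unfolding w by blast
    have "step (machine mul) c = c"
      using c(3) by (cases c) (simp add: machine_def split: if_splits)
    from bounded_run[OF c(1,2) this] obtain T where
      T: "run (machine mul) w T = c" "\<And>s. smp_run.ok as b (run (machine mul) w s)"
      by blast
    have "scanned_cells (machine mul) w t \<le> poly [:8, 8 + 4 * CARD('s), 4 * CARD('s):] (length w)"
      using smp_run.scanned_cells_le[of as b mul t] smp_run.space_bound[of as b] T(2)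
      unfolding w by (meson order_trans)
    moreover have "fst (run (machine mul) w T) =
        (if w \<in> SMP_language mul then tm_accept (machine mul) else tm_reject (machine mul))"
      using T(1) c(3) by (simp add: machine_def)
    ultimately show ?thesis by blast
  qed
  then show "decides (machine mul) (SMP_language mul)"
    unfolding decides_def by blast
  show "scanned_cells (machine mul) w t \<le> poly [:8, 8 + 4 * CARD('s), 4 * CARD('s):] (length w)"
    for w t
    using halt by blast
qed

end
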